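(* Let $R$ be an associative ring with identity that is right noetherian and left FP-injective. Then $R$ is quasi-Frobenius if and only if every nonzero complement left ideal of $R$ is not small.
   Context: Rings are associative with identity. A ring $R$ is quasi-Frobenius (QF) if $R$ is left or right noetherian and left or right self-injective (any choice of sides gives the same class of rings). $R$ is left FP-injective if for every free left $R$-module $F$ and every finitely generated $R$-submodule $N$ of $F$, every $R$-homomorphism $N\to R$ extends to an $R$-homomorphism $F\to R$. A left ideal $C$ of $R$ is a complement left ideal if there is a left ideal $S$ of $R$ such that $C$ is maximal among left ideals $C'$ with $C'\cap S=0$. A left ideal $I$ of $R$ is small if for every left ideal $K$ of $R$, $K+I=R$ implies $K=R$. *)

theory Defs
  imports "HOL-Algebra.Module" "HOL-Algebra.Ideal"
begin

text \<open>
  The locale \<open>module\<close> of the library is restricted to commutative base rings. The record type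
  \<open>module\<close> and the locale \<open>submodule\<close> are not, and are reused here. The fields \<open>mult\<close> and \<open>one\<close>
  of the module record play no role.
\<close>

locale left_module = R?: ring R + M?: abelian_group M
  for R :: "('a, 'r) ring_scheme" (structure) and M :: "('a, 'm, 'x) module_scheme" (structure) +
  assumes smult_closed [simp, intro]:
      "\<lbrakk>a \<in> carrier R; x \<in> carrier M\<rbrakk> \<Longrightarrow> a \<odot>\<^bsub>M\<^esub> x \<in> carrier M"
    and smult_l_distr:
      "\<lbrakk>a \<in> carrier R; b \<in> carrier R; x \<in> carrier M\<rbrakk> \<Longrightarrow>
        (a \<oplus>\<^bsub>R\<^esub> b) \<odot>\<^bsub>M\<^esub> x = a \<odot>\<^bsub>M\<^esub> x \<oplus>\<^bsub>M\<^esub> b \<odot>\<^bsub>M\<^esub> x"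
    and smult_r_distr:
      "\<lbrakk>a \<in> carrier R; x \<in> carrier M; y \<in> carrier M\<rbrakk> \<Longrightarrow>
        a \<odot>\<^bsub>M\<^esub> (x \<oplus>\<^bsub>M\<^esub> y) = a \<odot>\<^bsub>M\<^esub> x \<oplus>\<^bsub>M\<^esub> a \<odot>\<^bsub>M\<^esub> y"
    and smult_assoc:
      "\<lbrakk>a \<in> carrier R; b \<in> carrier R; x \<in> carrier M\<rbrakk> \<Longrightarrow>
        (a \<otimes>\<^bsub>R\<^esub> b) \<odot>\<^bsub>M\<^esub> x = a \<odot>\<^bsub>M\<^esub> (b \<odot>\<^bsub>M\<^esub> x)"
    and smult_one [simp]:
      "x \<in> carrier M \<Longrightarrow> \<one>\<^bsub>R\<^esub> \<odot>\<^bsub>M\<^esub> x = x"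

definition left_regular :: "('a, 'r) ring_scheme \<Rightarrow> ('a, 'a) module" where
  "left_regular R = \<lparr>carrier = carrier R, mult = mult R, one = one R,
     zero = zero R, add = add R, smult = mult R\<rparr>"

definition left_hom ::
  "('a, 'r) ring_scheme \<Rightarrow> ('a, 'm, 'x) module_scheme \<Rightarrow> ('a, 'n, 'y) module_scheme \<Rightarrow> ('m \<Rightarrow> 'n) set"
  where
  "left_hom R M N = {f \<in> carrier M \<rightarrow> carrier N.
     (\<forall>x\<in>carrier M. \<forall>y\<in>carrier M. f (x \<oplus>\<^bsub>M\<^esub> y) = f x \<oplus>\<^bsub>N\<^esub> f y) \<and>
     (\<forall>a\<in>carrier R. \<forall>x\<in>carrier M. f (a \<odot>\<^bsub>M\<^esub> x) = a \<odot>\<^bsub>N\<^esub> f x)}"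

definition left_span ::
  "('a, 'r) ring_scheme \<Rightarrow> ('a, 'm, 'x) module_scheme \<Rightarrow> 'm set \<Rightarrow> 'm set" where
  "left_span R M A = \<Inter>{N. submodule N R M \<and> A \<subseteq> N}"

definition fg_submodule ::
  "('a, 'r) ring_scheme \<Rightarrow> ('a, 'm, 'x) module_scheme \<Rightarrow> 'm set \<Rightarrow> bool" where
  "fg_submodule R M N \<longleftrightarrow> (\<exists>A. finite A \<and> A \<subseteq> carrier M \<and> N = left_span R M A)"

definition left_basis ::
  "('a, 'r) ring_scheme \<Rightarrow> ('a, 'm, 'x) module_scheme \<Rightarrow> 'm set \<Rightarrow> bool" where
  "left_basis R M B \<longleftrightarrow> B \<subseteq> carrier M \<and> left_span R M B = carrier M \<and>
     (\<forall>A c. finite A \<and> A \<subseteq> B \<and> c \<in> A \<rightarrow> carrier R \<and>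
        (\<Oplus>\<^bsub>M\<^esub>b\<in>A. c b \<odot>\<^bsub>M\<^esub> b) = \<zero>\<^bsub>M\<^esub> \<longrightarrow> (\<forall>b\<in>A. c b = \<zero>\<^bsub>R\<^esub>))"

definition free_left_module ::
  "('a, 'r) ring_scheme \<Rightarrow> ('a, 'm, 'x) module_scheme \<Rightarrow> bool" where
  "free_left_module R M \<longleftrightarrow> left_module R M \<and> (\<exists>B. left_basis R M B)"

text \<open>Right ideals and right modules over \<open>R\<close> are left ideals and left modules over
  \<open>opposite R\<close>; every right-sided notion below is defined in this way.\<close>

definition opposite :: "('a, 'r) ring_scheme \<Rightarrow> ('a, 'r) ring_scheme" where
  "opposite R = R\<lparr>mult := (\<lambda>x y. y \<otimes>\<^bsub>R\<^esub> x)\<rparr>"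

locale left_ideal = additive_subgroup I R + ring R for I and R (structure) +
  assumes I_l_closed: "\<lbrakk>a \<in> I; x \<in> carrier R\<rbrakk> \<Longrightarrow> x \<otimes> a \<in> I"

definition left_noetherian :: "('a, 'r) ring_scheme \<Rightarrow> bool" where
  "left_noetherian R \<longleftrightarrow> (\<forall>I :: nat \<Rightarrow> 'a set.
     (\<forall>n. left_ideal (I n) R \<and> I n \<subseteq> I (Suc n)) \<longrightarrow> (\<exists>m. \<forall>n\<ge>m. I n = I m))"

definition right_noetherian :: "('a, 'r) ring_scheme \<Rightarrow> bool" where
  "right_noetherian R \<longleftrightarrow> left_noetherian (opposite R)"

text \<open>
  Injectivity quantifies over all modules, which HOL can only do one carrier type at a time. The
  notions below therefore take a type argument, the type of the elements of the modules that are
  quantified over. It must be large enough to contain the modules one cares about: over a one-element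
  type, for example, only zero modules would be tested.
\<close>

definition left_self_injective :: "'m itself \<Rightarrow> ('a, 'r) ring_scheme \<Rightarrow> bool" where
  "left_self_injective (U :: 'm itself) R \<longleftrightarrow>
     (\<forall>(M :: ('a, 'm) module) N f.
        left_module R M \<and> submodule N R M \<and> f \<in> left_hom R (M\<lparr>carrier := N\<rparr>) (left_regular R) \<longrightarrow>
        (\<exists>g \<in> left_hom R M (left_regular R). \<forall>x\<in>N. g x = f x))"

definition right_self_injective :: "'m itself \<Rightarrow> ('a, 'r) ring_scheme \<Rightarrow> bool" where
  "right_self_injective U R \<longleftrightarrow> left_self_injective U (opposite R)"

definition left_fp_injective :: "'m itself \<Rightarrow> ('a, 'r) ring_scheme \<Rightarrow> bool" where
  "left_fp_injective (U :: 'm itself) R \<longleftrightarrow>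
     (\<forall>(F :: ('a, 'm) module) N f.
        free_left_module R F \<and> fg_submodule R F N \<and>
        f \<in> left_hom R (F\<lparr>carrier := N\<rparr>) (left_regular R) \<longrightarrow>
        (\<exists>g \<in> left_hom R F (left_regular R). \<forall>x\<in>N. g x = f x))"

definition quasi_frobenius :: "'m itself \<Rightarrow> ('a, 'r) ring_scheme \<Rightarrow> bool" where
  "quasi_frobenius U R \<longleftrightarrow> ring R \<and>
     (left_noetherian R \<or> right_noetherian R) \<and>
     (left_self_injective U R \<or> right_self_injective U R)"

text \<open>
  For a ring with elements in \<open>'a\<close>, this type has room for a copy of the ring itself and of all its
  one-sided ideals (hence, by Baer's criterion, self-injectivity relative to it does not depend on
  \<open>'m\<close>), for a copy of every free module of finite rank (hence the same holds for FP-injectivity), and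
  for all modules with elements in the arbitrary type \<open>'m\<close>.
\<close>

type_synonym ('a, 'm) module_universe = "(nat \<Rightarrow> 'a) + 'm"

definition complement_left_ideal :: "'a set \<Rightarrow> ('a, 'r) ring_scheme \<Rightarrow> bool" where
  "complement_left_ideal C R \<longleftrightarrow> left_ideal C R \<and>
     (\<exists>S. left_ideal S R \<and> C \<inter> S = {\<zero>\<^bsub>R\<^esub>} \<and>
        (\<forall>C'. left_ideal C' R \<and> C' \<inter> S = {\<zero>\<^bsub>R\<^esub>} \<and> C \<subseteq> C' \<longrightarrow> C' = C))"

definition small_left_ideal :: "'a set \<Rightarrow> ('a, 'r) ring_scheme \<Rightarrow> bool" where
  "small_left_ideal I R \<longleftrightarrow> left_ideal I R \<and>
     (\<forall>K. left_ideal K R \<and> K <+>\<^bsub>R\<^esub> I = carrier R \<longrightarrow> K = carrier R)"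

end

theory Submission
  imports Defs "HOL-Algebra.Multiplicative_Group"
begin

text \<open>
  Write \<open>l\<close> and \<open>r\<close> for left and right annihilators, and \<open>Z\<close> for the left singular ideal of \<open>R\<close>: the
  elements whose left annihilator is an essential left ideal. Both implications pass through one
  condition, \<open>nonsingular_idempotents\<close>: if \<open>x\<close> is not in \<open>Z\<close>, then \<open>xR\<close> contains a nonzero idempotent.

  FP-injectivity is used for row vectors. Rows of length one show that every homomorphism from a left
  ideal to \<open>R\<close> agrees on any finite set with a right multiplication; cyclic modules of longer rows,
  together with the noetherian hypothesis, give \<open>r (l T) = T\<close> for every right ideal \<open>T\<close>. It follows that
  \<open>1 - w\<close> is a unit for \<open>w\<close> in \<open>Z\<close>, then, by an argument in the style of Nakayama's lemma, that \<open>Z\<close> is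
  nilpotent (\<open>singular_power_nilpotent\<close>). In particular idempotents lift modulo \<open>Z\<close>.

  The condition implies that \<open>R\<close> is left self-injective. Given a right ideal \<open>T \<noteq> R\<close>, choose \<open>x\<close> outside
  \<open>T\<close> with \<open>xZ \<subseteq> T\<close>, and then an idempotent \<open>e\<close> with \<open>xe\<close> outside \<open>T\<close> for which \<open>(1 - e)R\<close> is maximal. The
  condition forces \<open>T + xeR\<close> to cover \<open>T\<close> (\<open>right_ideal_cover\<close>), and a noetherian lattice of right ideals
  in which every proper right ideal has a cover satisfies the descending chain condition. For a
  homomorphism \<open>f\<close> from a left ideal \<open>I\<close>, take a finite \<open>K \<subseteq> I\<close> with \<open>r K\<close> minimal: a right
  multiplication that agrees with \<open>f\<close> on \<open>K\<close> agrees with it on \<open>I\<close>. Baer's criterion does the rest.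

  Suppose that no nonzero complement left ideal is small, and let \<open>x\<close> be outside \<open>Z\<close>. Then right
  multiplication by \<open>x\<close> is injective on some \<open>Ry \<noteq> 0\<close>. A nonzero \<open>d\<close> in \<open>Ry\<close> with \<open>r d\<close> maximal generates a
  uniform left ideal, which is essential in a complement \<open>C\<close>. Since left ideals inside \<open>Z\<close> are small, \<open>C\<close>
  contains an element outside \<open>Z\<close>. From it one obtains an element of \<open>C\<close> that is idempotent modulo \<open>Z\<close>
  and not in \<open>Z\<close>, and then a nonzero idempotent \<open>f\<close> in \<open>C\<close>. As \<open>x\<close> acts injectively on \<open>Rf\<close>, one has
  \<open>f = fxs\<close> for some \<open>s\<close>, and \<open>xsf\<close> is the idempotent sought.

  Conversely, let \<open>R\<close> be quasi-Frobenius. If \<open>R\<close> is left self-injective and \<open>C\<close> is a complement of \<open>S\<close>, the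
  projection of \<open>C + S\<close> to \<open>C\<close> is a right multiplication by an element that is idempotent modulo \<open>Z\<close>;
  lifting it shows that \<open>C = Re\<close> for an idempotent \<open>e\<close>, and \<open>Re\<close> is small only if \<open>e = 0\<close>. If \<open>R\<close> is right
  self-injective, the same construction in the opposite ring yields \<open>nonsingular_idempotents\<close>, so that
  \<open>R\<close> is left self-injective as well.
\<close>

section \<open>One-sided ideals\<close>

context ring
begin

lemma left_ideal_iff:
  "left_ideal I R \<longleftrightarrow> I \<subseteq> carrier R \<and> \<zero> \<in> I \<and> (\<forall>a\<in>I. \<forall>b\<in>I. a \<oplus> b \<in> I) \<and>
     (\<forall>r\<in>carrier R. \<forall>a\<in>I. r \<otimes> a \<in> I)"
proof
  assume "left_ideal I R"
  then interpret left_ideal I R .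
  show "I \<subseteq> carrier R \<and> \<zero> \<in> I \<and> (\<forall>a\<in>I. \<forall>b\<in>I. a \<oplus> b \<in> I) \<and>
     (\<forall>r\<in>carrier R. \<forall>a\<in>I. r \<otimes> a \<in> I)"
    using a_subset I_l_closed by auto
next
  assume I: "I \<subseteq> carrier R \<and> \<zero> \<in> I \<and> (\<forall>a\<in>I. \<forall>b\<in>I. a \<oplus> b \<in> I) \<and>
     (\<forall>r\<in>carrier R. \<forall>a\<in>I. r \<otimes> a \<in> I)"
  have neg: "\<ominus> a \<in> I" if "a \<in> I" for a
  proof -
    have "\<ominus> \<one> \<otimes> a \<in> I" using I that by auto
    moreover have "\<ominus> \<one> \<otimes> a = \<ominus> a" using I that l_minus by auto
    ultimately show ?thesis by simp
  qed
  have "subgroup I (add_monoid R)"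
    by (rule add.subgroupI) (use I neg in \<open>auto simp: a_inv_def\<close>)
  then show "left_ideal I R"
    using I by (auto simp: left_ideal_def left_ideal_axioms_def additive_subgroup_def ring_axioms)
qed

lemma left_idealI:
  assumes "I \<subseteq> carrier R" "\<zero> \<in> I" "\<And>a b. \<lbrakk>a \<in> I; b \<in> I\<rbrakk> \<Longrightarrow> a \<oplus> b \<in> I"
    "\<And>r a. \<lbrakk>r \<in> carrier R; a \<in> I\<rbrakk> \<Longrightarrow> r \<otimes> a \<in> I"
  shows "left_ideal I R"
  using assms by (simp add: left_ideal_iff)

lemma left_idealD:
  assumes "left_ideal I R"
  shows "I \<subseteq> carrier R" "\<And>a. a \<in> I \<Longrightarrow> a \<in> carrier R" "\<zero> \<in> I"
    "\<And>a b. \<lbrakk>a \<in> I; b \<in> I\<rbrakk> \<Longrightarrow> a \<oplus> b \<in> I"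
    "\<And>r a. \<lbrakk>r \<in> carrier R; a \<in> I\<rbrakk> \<Longrightarrow> r \<otimes> a \<in> I"
    "\<And>a. a \<in> I \<Longrightarrow> \<ominus> a \<in> I" "\<And>a b. \<lbrakk>a \<in> I; b \<in> I\<rbrakk> \<Longrightarrow> a \<ominus> b \<in> I"
proof -
  interpret left_ideal I R by fact
  show "I \<subseteq> carrier R" "\<And>a. a \<in> I \<Longrightarrow> a \<in> carrier R" "\<zero> \<in> I"
    "\<And>a b. \<lbrakk>a \<in> I; b \<in> I\<rbrakk> \<Longrightarrow> a \<oplus> b \<in> I"
    "\<And>r a. \<lbrakk>r \<in> carrier R; a \<in> I\<rbrakk> \<Longrightarrow> r \<otimes> a \<in> I"
    and neg: "\<And>a. a \<in> I \<Longrightarrow> \<ominus> a \<in> I"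
    using a_subset I_l_closed by auto
  then show "\<And>a b. \<lbrakk>a \<in> I; b \<in> I\<rbrakk> \<Longrightarrow> a \<ominus> b \<in> I" by (simp add: minus_eq)
qed

lemma left_ideal_zero: "left_ideal {\<zero>} R"
  by (rule left_idealI) auto

lemma left_ideal_carrier: "left_ideal (carrier R) R"
  by (rule left_idealI) auto

lemma left_ideal_principal:
  assumes "a \<in> carrier R"
  shows "left_ideal (PIdl a) R"
proof (rule left_idealI)
  show "PIdl a \<subseteq> carrier R" using assms by (auto simp: cgenideal_def)
  show "\<zero> \<in> PIdl a" using assms by (auto simp: cgenideal_def intro!: exI[of _ \<zero>])
  show "x \<oplus> y \<in> PIdl a" if xy: "x \<in> PIdl a" "y \<in> PIdl a" for x y
  proof -
    obtain r s where "r \<in> carrier R" "s \<in> carrier R" "x = r \<otimes> a" "y = s \<otimes> a"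
      using xy by (auto simp: cgenideal_def)
    then have "r \<oplus> s \<in> carrier R" "x \<oplus> y = (r \<oplus> s) \<otimes> a" using assms by (auto simp: l_distr)
    then show ?thesis by (auto simp: cgenideal_def)
  qed
  show "r \<otimes> x \<in> PIdl a" if rx: "r \<in> carrier R" "x \<in> PIdl a" for r x
  proof -
    obtain s where "s \<in> carrier R" "x = s \<otimes> a" using rx by (auto simp: cgenideal_def)
    then have "r \<otimes> s \<in> carrier R" "r \<otimes> x = (r \<otimes> s) \<otimes> a" using assms rx by (auto simp: m_assoc)
    then show ?thesis by (auto simp: cgenideal_def)
  qed
qed

lemma principal_self: "a \<in> carrier R \<Longrightarrow> a \<in> PIdl a"
  unfolding cgenideal_def by (auto intro: exI[of _ \<one>])

lemma left_ideal_sum: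
  assumes "left_ideal I R" "left_ideal J R"
  shows "left_ideal (I <+>\<^bsub>R\<^esub> J) R" "I \<subseteq> I <+>\<^bsub>R\<^esub> J" "J \<subseteq> I <+>\<^bsub>R\<^esub> J"
proof -
  note I = left_idealD[OF assms(1)] and J = left_idealD[OF assms(2)]
  show "left_ideal (I <+>\<^bsub>R\<^esub> J) R"
  proof (rule left_idealI)
    show "I <+>\<^bsub>R\<^esub> J \<subseteq> carrier R" using I(2) J(2) by (auto simp: set_add_def')
    show "\<zero> \<in> I <+>\<^bsub>R\<^esub> J" using I(3) J(3) by (force simp: set_add_def')
    show "x \<oplus> y \<in> I <+>\<^bsub>R\<^esub> J" if xy: "x \<in> I <+>\<^bsub>R\<^esub> J" "y \<in> I <+>\<^bsub>R\<^esub> J" for x y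
    proof -
      obtain i j k l where "i \<in> I" "j \<in> J" "x = i \<oplus> j" "k \<in> I" "l \<in> J" "y = k \<oplus> l"
        using xy by (auto simp: set_add_def')
      then have "x \<oplus> y = (i \<oplus> k) \<oplus> (j \<oplus> l)" "i \<oplus> k \<in> I" "j \<oplus> l \<in> J"
        using I J by (auto simp: a_ac)
      then show ?thesis by (auto simp: set_add_def')
    qed
    show "r \<otimes> x \<in> I <+>\<^bsub>R\<^esub> J" if rx: "r \<in> carrier R" "x \<in> I <+>\<^bsub>R\<^esub> J" for r x
    proof -
      obtain i j where "i \<in> I" "j \<in> J" "x = i \<oplus> j"
        using rx by (auto simp: set_add_def')
      then have "r \<otimes> x = r \<otimes> i \<oplus> r \<otimes> j" "r \<otimes> i \<in> I" "r \<otimes> j \<in> J"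
        using I J rx by (auto simp: r_distr)
      then show ?thesis by (auto simp: set_add_def')
    qed
  qed
  show "I \<subseteq> I <+>\<^bsub>R\<^esub> J"
  proof
    fix x assume "x \<in> I"
    then have "x = x \<oplus> \<zero>" using I by simp
    then show "x \<in> I <+>\<^bsub>R\<^esub> J" using \<open>x \<in> I\<close> J(3) by (auto simp: set_add_def')
  qed
  show "J \<subseteq> I <+>\<^bsub>R\<^esub> J"
  proof
    fix x assume "x \<in> J"
    then have "x = \<zero> \<oplus> x" using J by simp
    then show "x \<in> I <+>\<^bsub>R\<^esub> J" using \<open>x \<in> J\<close> I(3) by (auto simp: set_add_def')
  qed
qed

end

abbreviation right_ideal :: "'a set \<Rightarrow> ('a, 'r) ring_scheme \<Rightarrow> bool" where
  "right_ideal T R \<equiv> left_ideal T (opposite R)"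

lemma opposite_simps [simp]:
  "carrier (opposite R) = carrier R" "\<zero>\<^bsub>opposite R\<^esub> = \<zero>\<^bsub>R\<^esub>" "\<one>\<^bsub>opposite R\<^esub> = \<one>\<^bsub>R\<^esub>"
  "x \<oplus>\<^bsub>opposite R\<^esub> y = x \<oplus>\<^bsub>R\<^esub> y" "x \<otimes>\<^bsub>opposite R\<^esub> y = y \<otimes>\<^bsub>R\<^esub> x"
  "A <+>\<^bsub>opposite R\<^esub> B = A <+>\<^bsub>R\<^esub> B" "\<ominus>\<^bsub>opposite R\<^esub> x = \<ominus>\<^bsub>R\<^esub> x" "x \<ominus>\<^bsub>opposite R\<^esub> y = x \<ominus>\<^bsub>R\<^esub> y"
  by (simp_all add: opposite_def set_add_def' a_inv_def a_minus_def)

context ring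
begin

lemma opposite_ring: "ring (opposite R)"
proof (rule ringI)
  have "add_monoid (opposite R) = add_monoid R" by (simp add: opposite_def)
  then show "abelian_group (opposite R)"
    by (metis abelian_group_axioms abelian_group_def abelian_group_axioms_def abelian_monoid_def)
  show "monoid (opposite R)"
    by (rule monoidI) (auto simp: m_assoc)
qed (auto simp: l_distr r_distr)

lemma right_idealI:
  assumes "I \<subseteq> carrier R" "\<zero> \<in> I" "\<And>a b. \<lbrakk>a \<in> I; b \<in> I\<rbrakk> \<Longrightarrow> a \<oplus> b \<in> I"
    "\<And>r a. \<lbrakk>r \<in> carrier R; a \<in> I\<rbrakk> \<Longrightarrow> a \<otimes> r \<in> I"
  shows "right_ideal I R"
  using ring.left_idealI[OF opposite_ring, of I] assms by simp

lemmas right_idealD = ring.left_idealD[OF opposite_ring, simplified]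
lemmas right_ideal_zero = ring.left_ideal_zero[OF opposite_ring, simplified]
lemmas right_ideal_principal = ring.left_ideal_principal[OF opposite_ring, simplified]
lemmas right_ideal_sum = ring.left_ideal_sum[OF opposite_ring, simplified]

lemma right_principal_def: "PIdl\<^bsub>opposite R\<^esub> a = {a \<otimes> x |x. x \<in> carrier R}"
  by (simp add: cgenideal_def)

end

section \<open>Annihilators\<close>

definition left_ann :: "('a, 'r) ring_scheme \<Rightarrow> 'a set \<Rightarrow> 'a set" where
  "left_ann R A = {x \<in> carrier R. \<forall>a\<in>A. x \<otimes>\<^bsub>R\<^esub> a = \<zero>\<^bsub>R\<^esub>}"

abbreviation right_ann :: "('a, 'r) ring_scheme \<Rightarrow> 'a set \<Rightarrow> 'a set" where
  "right_ann R A \<equiv> left_ann (opposite R) A"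

context ring
begin

lemma left_ideal_left_ann: "A \<subseteq> carrier R \<Longrightarrow> left_ideal (left_ann R A) R"
  by (rule left_idealI) (auto simp: left_ann_def l_distr m_assoc subset_iff)

lemmas right_ideal_right_ann = ring.left_ideal_left_ann[OF opposite_ring, simplified]

end

section \<open>Chain conditions and Zorn's lemma\<close>

text \<open>
  Choosing a strictly larger member for each member of a family without maximal elements would
  produce a strictly ascending chain.
\<close>

lemma left_noetherian_maximal:
  assumes "left_noetherian R" and ne: "F \<noteq> {}" and ideals: "\<And>I. I \<in> F \<Longrightarrow> left_ideal I R"
  shows "\<exists>M\<in>F. \<forall>I\<in>F. M \<subseteq> I \<longrightarrow> I = M"
proof (rule ccontr)
  assume "\<not> ?thesis"
  then have "\<forall>M\<in>F. \<exists>I. I \<in> F \<and> M \<subset> I" by blast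
  then obtain g where g: "\<And>M. M \<in> F \<Longrightarrow> g M \<in> F \<and> M \<subset> g M" by metis
  obtain I0 where I0: "I0 \<in> F" using ne by blast
  define c where "c n = (g ^^ n) I0" for n
  have cF: "c n \<in> F" for n by (induction n) (auto simp: c_def I0 g)
  have "c n \<subset> c (Suc n)" for n using g[OF cF[of n]] by (simp add: c_def)
  moreover have "\<exists>m. \<forall>n\<ge>m. c n = c m"
    using assms(1) cF ideals calculation unfolding left_noetherian_def by blast
  ultimately show False by (metis Suc_n_not_le_n nat_le_linear psubset_eq)
qed

lemma right_noetherian_maximal:
  assumes "right_noetherian R" "F \<noteq> {}" "\<And>I. I \<in> F \<Longrightarrow> right_ideal I R"
  shows "\<exists>M\<in>F. \<forall>I\<in>F. M \<subseteq> I \<longrightarrow> I = M"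
  using assms left_noetherian_maximal[of "opposite R" F] unfolding right_noetherian_def by simp

text \<open>
  When \<open>B\<close> is a left ideal, \<open>C\<close> is a complement left ideal, and it can be made to contain a prescribed
  left ideal \<open>A\<close> that meets \<open>B\<close> only in \<open>0\<close>.
\<close>

lemma (in ring) left_ideal_maximal_disjoint:
  assumes A: "left_ideal A R" and disj: "A \<inter> B = {\<zero>}"
  shows "\<exists>C. left_ideal C R \<and> A \<subseteq> C \<and> C \<inter> B = {\<zero>} \<and>
    (\<forall>C'. left_ideal C' R \<and> C' \<inter> B = {\<zero>} \<and> C \<subseteq> C' \<longrightarrow> C' = C)"
proof -
  define F where "F = {C. left_ideal C R \<and> A \<subseteq> C \<and> C \<inter> B = {\<zero>}}"
  have "\<exists>M\<in>F. \<forall>X\<in>F. M \<subseteq> X \<longrightarrow> X = M"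
  proof (rule subset_Zorn_nonempty)
    show "F \<noteq> {}" using assms by (auto simp: F_def)
    fix K assume K: "K \<noteq> {}" "subset.chain F K"
    then have KF: "\<And>C. C \<in> K \<Longrightarrow> left_ideal C R \<and> A \<subseteq> C \<and> C \<inter> B = {\<zero>}"
      by (auto simp: subset.chain_def F_def)
    have "left_ideal (\<Union>K) R"
    proof (rule left_idealI)
      show "\<Union>K \<subseteq> carrier R" using KF left_idealD(1) by blast
      show "\<zero> \<in> \<Union>K" using KF K(1) left_idealD(3) by blast
      show "a \<oplus> b \<in> \<Union>K" if ab: "a \<in> \<Union>K" "b \<in> \<Union>K" for a b
      proof -
        obtain X where "X \<in> K" "a \<in> X" "b \<in> X"
          using ab K(2) unfolding subset.chain_def by blast
        then show ?thesis using KF left_idealD(4) by blast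
      qed
      show "r \<otimes> a \<in> \<Union>K" if "r \<in> carrier R" "a \<in> \<Union>K" for r a
        using that KF left_idealD(5) by blast
    qed
    then show "\<Union>K \<in> F" using K(1) KF by (auto simp: F_def)
  qed
  then obtain M where M: "M \<in> F" "\<forall>X\<in>F. M \<subseteq> X \<longrightarrow> X = M" by (elim bexE)
  then have "A \<subseteq> M" by (simp add: F_def)
  show ?thesis
  proof (intro exI conjI allI impI)
    fix C' assume "left_ideal C' R \<and> C' \<inter> B = {\<zero>} \<and> M \<subseteq> C'"
    then show "C' = M" using M(2) \<open>A \<subseteq> M\<close> by (auto simp: F_def)
  qed (use M(1) in \<open>simp_all add: F_def\<close>)
qed

section \<open>Homomorphisms from left ideals and from row modules\<close>

abbreviation ideal_homs :: "('a, 'r) ring_scheme \<Rightarrow> 'a set \<Rightarrow> ('a \<Rightarrow> 'a) set" where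
  "ideal_homs R I \<equiv> left_hom R ((left_regular R)\<lparr>carrier := I\<rparr>) (left_regular R)"

lemma left_regular_simps [simp]:
  "carrier (left_regular R) = carrier R" "zero (left_regular R) = zero R"
  "add (left_regular R) = add R" "smult (left_regular R) = mult R"
  by (simp_all add: left_regular_def)

lemma ideal_homs_iff:
  "f \<in> ideal_homs R I \<longleftrightarrow> f \<in> I \<rightarrow> carrier R \<and>
     (\<forall>x\<in>I. \<forall>y\<in>I. f (x \<oplus>\<^bsub>R\<^esub> y) = f x \<oplus>\<^bsub>R\<^esub> f y) \<and>
     (\<forall>a\<in>carrier R. \<forall>x\<in>I. f (a \<otimes>\<^bsub>R\<^esub> x) = a \<otimes>\<^bsub>R\<^esub> f x)"
  by (simp add: left_hom_def)

text \<open>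
  The free left module of rows of length \<open>n\<close>, realised as the sequences that vanish from index \<open>n\<close>
  on, and embedded into the type of modules against which injectivity is tested. Rows of length one
  contain a copy of every left ideal.
\<close>

definition row_module :: "('a, 'r) ring_scheme \<Rightarrow> nat \<Rightarrow> ('a, ('a, 'm) module_universe) module"
  where "row_module R n = \<lparr>
     carrier = Inl ` {v. (\<forall>i. v i \<in> carrier R) \<and> (\<forall>i\<ge>n. v i = \<zero>\<^bsub>R\<^esub>)},
     mult = undefined, one = undefined,
     zero = Inl (\<lambda>_. \<zero>\<^bsub>R\<^esub>),
     add = (\<lambda>p q. Inl (\<lambda>i. projl p i \<oplus>\<^bsub>R\<^esub> projl q i)),
     smult = (\<lambda>a p. Inl (\<lambda>i. a \<otimes>\<^bsub>R\<^esub> projl p i))\<rparr>"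

definition unit_row :: "('a, 'r) ring_scheme \<Rightarrow> nat \<Rightarrow> ('a, 'm) module_universe" where
  "unit_row R k = Inl (\<lambda>i. if i = k then \<one>\<^bsub>R\<^esub> else \<zero>\<^bsub>R\<^esub>)"

lemma row_module_carrier:
  "Inl v \<in> carrier (row_module R n) \<longleftrightarrow> (\<forall>i. v i \<in> carrier R) \<and> (\<forall>i\<ge>n. v i = \<zero>\<^bsub>R\<^esub>)"
  by (auto simp: row_module_def)

lemma row_module_carrierE:
  assumes "p \<in> carrier (row_module R n)"
  obtains v where "p = Inl v" "\<And>i. v i \<in> carrier R" "\<And>i. i \<ge> n \<Longrightarrow> v i = \<zero>\<^bsub>R\<^esub>"
  using assms by (auto simp: row_module_def)

lemma row_module_simps [simp]:
  "\<zero>\<^bsub>row_module R n\<^esub> = Inl (\<lambda>_. \<zero>\<^bsub>R\<^esub>)"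
  "Inl v \<oplus>\<^bsub>row_module R n\<^esub> Inl w = Inl (\<lambda>i. v i \<oplus>\<^bsub>R\<^esub> w i)"
  "a \<odot>\<^bsub>row_module R n\<^esub> Inl v = Inl (\<lambda>i. a \<otimes>\<^bsub>R\<^esub> v i)"
  by (simp_all add: row_module_def)

context left_module
begin

lemma smult_l_zero: "x \<in> carrier M \<Longrightarrow> \<zero>\<^bsub>R\<^esub> \<odot>\<^bsub>M\<^esub> x = \<zero>\<^bsub>M\<^esub>"
proof -
  assume x: "x \<in> carrier M"
  have "\<zero>\<^bsub>R\<^esub> \<odot>\<^bsub>M\<^esub> x \<oplus>\<^bsub>M\<^esub> \<zero>\<^bsub>R\<^esub> \<odot>\<^bsub>M\<^esub> x = \<zero>\<^bsub>R\<^esub> \<odot>\<^bsub>M\<^esub> x"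
    using smult_l_distr[of "\<zero>\<^bsub>R\<^esub>" "\<zero>\<^bsub>R\<^esub>" x] x by simp
  then show ?thesis using x
    by (metis M.add.l_cancel_one R.zero_closed smult_closed)
qed

lemma smult_l_minus_one: "x \<in> carrier M \<Longrightarrow> (\<ominus>\<^bsub>R\<^esub> \<one>\<^bsub>R\<^esub>) \<odot>\<^bsub>M\<^esub> x = \<ominus>\<^bsub>M\<^esub> x"
proof -
  assume x: "x \<in> carrier M"
  have "(\<ominus>\<^bsub>R\<^esub> \<one>\<^bsub>R\<^esub>) \<odot>\<^bsub>M\<^esub> x \<oplus>\<^bsub>M\<^esub> x = (\<ominus>\<^bsub>R\<^esub> \<one>\<^bsub>R\<^esub> \<oplus>\<^bsub>R\<^esub> \<one>\<^bsub>R\<^esub>) \<odot>\<^bsub>M\<^esub> x"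
    using smult_l_distr[of "\<ominus>\<^bsub>R\<^esub> \<one>\<^bsub>R\<^esub>" "\<one>\<^bsub>R\<^esub>" x] x by simp
  also have "\<dots> = \<zero>\<^bsub>M\<^esub>" using x smult_l_zero by (simp add: R.l_neg)
  finally show ?thesis using x by (metis M.minus_equality R.add.inv_closed R.one_closed smult_closed)
qed

lemma submodule_iff:
  "submodule N R M \<longleftrightarrow> N \<subseteq> carrier M \<and> \<zero>\<^bsub>M\<^esub> \<in> N \<and> (\<forall>x\<in>N. \<forall>y\<in>N. x \<oplus>\<^bsub>M\<^esub> y \<in> N) \<and>
     (\<forall>a\<in>carrier R. \<forall>x\<in>N. a \<odot>\<^bsub>M\<^esub> x \<in> N)"
proof
  assume "submodule N R M"
  then show "N \<subseteq> carrier M \<and> \<zero>\<^bsub>M\<^esub> \<in> N \<and> (\<forall>x\<in>N. \<forall>y\<in>N. x \<oplus>\<^bsub>M\<^esub> y \<in> N) \<and>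
     (\<forall>a\<in>carrier R. \<forall>x\<in>N. a \<odot>\<^bsub>M\<^esub> x \<in> N)"
    by (auto simp: submodule_def submodule_axioms_def subgroup_def)
next
  assume N: "N \<subseteq> carrier M \<and> \<zero>\<^bsub>M\<^esub> \<in> N \<and> (\<forall>x\<in>N. \<forall>y\<in>N. x \<oplus>\<^bsub>M\<^esub> y \<in> N) \<and>
     (\<forall>a\<in>carrier R. \<forall>x\<in>N. a \<odot>\<^bsub>M\<^esub> x \<in> N)"
  have "\<ominus>\<^bsub>M\<^esub> x \<in> N" if "x \<in> N" for x
    using N that smult_l_minus_one[of x] by (metis R.add.inv_closed R.one_closed subsetD)
  then have "subgroup N (add_monoid M)"
    by (intro M.add.subgroupI) (use N in \<open>auto simp: a_inv_def\<close>)
  then show "submodule N R M" using N by (simp add: submodule_def submodule_axioms_def)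
qed

end

context ring
begin

lemma row_module_left_module:
  "left_module R (row_module R n :: ('a, ('a, 'm) module_universe) module)"
proof (intro left_module.intro left_module_axioms.intro ring_axioms)
  let ?F = "row_module R n :: ('a, ('a, 'm) module_universe) module"
  show "abelian_group ?F"
  proof (rule abelian_groupI)
    fix x y z assume "x \<in> carrier ?F" "y \<in> carrier ?F" "z \<in> carrier ?F"
    then show "x \<oplus>\<^bsub>?F\<^esub> y \<oplus>\<^bsub>?F\<^esub> z = x \<oplus>\<^bsub>?F\<^esub> (y \<oplus>\<^bsub>?F\<^esub> z)"
      by (elim row_module_carrierE) (simp add: a_assoc)
  next
    fix x assume "x \<in> carrier ?F"
    then obtain v where v: "x = Inl v" "\<And>i. v i \<in> carrier R" "\<And>i. i \<ge> n \<Longrightarrow> v i = \<zero>"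
      by (elim row_module_carrierE) auto
    show "\<exists>y\<in>carrier ?F. y \<oplus>\<^bsub>?F\<^esub> x = \<zero>\<^bsub>?F\<^esub>"
      by (rule bexI[of _ "Inl (\<lambda>i. \<ominus> v i)"])
        (use v in \<open>auto simp: l_neg row_module_carrier\<close>)
  qed (auto elim!: row_module_carrierE simp: row_module_carrier a_comm)
qed (auto elim!: row_module_carrierE simp: row_module_carrier l_distr r_distr m_assoc)

lemma unit_row_closed: "k < n \<Longrightarrow> unit_row R k \<in> carrier (row_module R n)"
  by (simp add: unit_row_def row_module_carrier)

text \<open>
  Truncating a row after each of its coordinates builds it up from \<open>0\<close> by adding multiples of unit
  rows. Both the fact that unit rows span and the evaluation of homomorphisms on rows are instances.
\<close>

lemma row_induct:
  fixes v :: "nat \<Rightarrow> 'a" and n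
  defines "F \<equiv> row_module R n :: ('a, ('a, 'm) module_universe) module"
  assumes v: "Inl v \<in> carrier F"
    and zero: "P \<zero>\<^bsub>F\<^esub>"
    and step: "\<And>k p. \<lbrakk>k < n; p \<in> carrier F; P p\<rbrakk> \<Longrightarrow> P (p \<oplus>\<^bsub>F\<^esub> v k \<odot>\<^bsub>F\<^esub> unit_row R k)"
  shows "P (Inl v)"
proof -
  define cut where "cut k = (Inl (\<lambda>i. if i < k then v i else \<zero>) :: ('a, 'm) module_universe)" for k
  have vc: "\<And>i. v i \<in> carrier R" "\<And>i. i \<ge> n \<Longrightarrow> v i = \<zero>"
    using v by (auto simp: F_def row_module_carrier)
  have "k \<le> n \<Longrightarrow> P (cut k)" for k
  proof (induction k)
    case 0
    then show ?case using zero by (simp add: cut_def F_def)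
  next
    case (Suc k)
    have "cut (Suc k) = cut k \<oplus>\<^bsub>F\<^esub> v k \<odot>\<^bsub>F\<^esub> unit_row R k"
      using vc by (auto simp: cut_def F_def unit_row_def less_Suc_eq)
    moreover have "cut k \<in> carrier F" using vc Suc by (auto simp: cut_def F_def row_module_carrier)
    ultimately show ?case using step[of k "cut k"] Suc by simp
  qed
  moreover have "cut n = Inl v" using vc by (auto simp: cut_def)
  ultimately show ?thesis by (metis order_refl)
qed

text \<open>This is what reads off the coefficients of a linear combination of unit rows.\<close>

lemma row_module_finsum_projl:
  fixes n
  defines "F \<equiv> row_module R n :: ('a, ('a, 'm) module_universe) module"
  assumes "finite A" "h \<in> A \<rightarrow> carrier F"
  shows "projl (\<Oplus>\<^bsub>F\<^esub>b\<in>A. h b) j = (\<Oplus>b\<in>A. projl (h b) j)"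
proof -
  interpret F: left_module R F unfolding F_def by (rule row_module_left_module)
  have projl_closed: "projl p j \<in> carrier R" if "p \<in> carrier F" for p
    using that by (auto simp: F_def elim: row_module_carrierE)
  show ?thesis using assms(2,3)
  proof (induction A rule: finite_induct)
    case empty
    have "finsum F h {} = \<zero>\<^bsub>F\<^esub>" by simp
    then show ?case by (simp add: F_def)
  next
    case (insert b A)
    have h: "h b \<in> carrier F" "finsum F h A \<in> carrier F" using insert.prems by auto
    have "projl (h b \<oplus>\<^bsub>F\<^esub> finsum F h A) j = projl (h b) j \<oplus> projl (finsum F h A) j"
      using h by (auto simp: F_def elim!: row_module_carrierE)
    then show ?case
      using insert projl_closed by (simp add: finsum_insert F.M.finsum_insert Pi_def)
  qed
qed

lemma row_module_free: "free_left_module R (row_module R n :: ('a, ('a, 'm) module_universe) module)"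
proof -
  let ?F = "row_module R n :: ('a, ('a, 'm) module_universe) module"
  let ?E = "unit_row R ` {..<n} :: ('a, 'm) module_universe set"
  interpret F: left_module R ?F by (rule row_module_left_module)
  have EF: "?E \<subseteq> carrier ?F" using unit_row_closed by blast
  have "carrier ?F \<subseteq> N" if N: "submodule N R ?F" "?E \<subseteq> N" for N
  proof
    fix p assume "p \<in> carrier ?F"
    then obtain v where v: "p = Inl v" "\<And>i. v i \<in> carrier R" by (elim row_module_carrierE) auto
    show "p \<in> N" unfolding v(1)
    proof (rule row_induct)
      show "Inl v \<in> carrier ?F" using \<open>p \<in> carrier ?F\<close> v by simp
    qed (use N v(2) in \<open>auto simp: F.submodule_iff image_subset_iff simp del: row_module_simps\<close>)
  qed
  moreover have "submodule (carrier ?F) R ?F" by (simp add: F.submodule_iff del: row_module_simps)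
  ultimately have span: "left_span R ?F ?E = carrier ?F"
    using EF unfolding left_span_def by blast
  have "c b = \<zero>" if A: "finite A" "A \<subseteq> ?E" "c \<in> A \<rightarrow> carrier R"
    "(\<Oplus>\<^bsub>?F\<^esub>b\<in>A. c b \<odot>\<^bsub>?F\<^esub> b) = \<zero>\<^bsub>?F\<^esub>" "b \<in> A" for A c b
  proof -
    obtain j where j: "j < n" "b = unit_row R j" using A by blast
    have "\<zero> = projl (\<Oplus>\<^bsub>?F\<^esub>b\<in>A. c b \<odot>\<^bsub>?F\<^esub> b) j" using A(4) by simp
    also have "\<dots> = (\<Oplus>b\<in>A. projl (c b \<odot>\<^bsub>?F\<^esub> b) j)"
      by (rule row_module_finsum_projl[OF A(1)]) (use A(2,3) EF in \<open>blast intro: F.smult_closed\<close>)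
    \<comment> \<open>Rows rather than indices are compared, since all unit rows coincide over the zero ring.\<close>
    also have "\<dots> = (\<Oplus>x\<in>A. if b = x then c x else \<zero>)"
    proof (rule finsum_cong')
      fix x assume x: "x \<in> A"
      then obtain k where k: "x = unit_row R k" using A by blast
      have "c x \<in> carrier R" using x A by auto
      have "projl (c x \<odot>\<^bsub>?F\<^esub> x) j = c x \<otimes> (if j = k then \<one> else \<zero>)"
        unfolding k by (simp add: unit_row_def)
      moreover have "projl (c b \<odot>\<^bsub>?F\<^esub> b) j = c b \<otimes> \<one>"
        unfolding j by (simp add: unit_row_def)
      ultimately show "projl (c x \<odot>\<^bsub>?F\<^esub> x) j = (if b = x then c x else \<zero>)"
        using \<open>c x \<in> carrier R\<close> k j by (cases "b = x"; cases "j = k") auto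
    qed (use A in auto)
    also have "\<dots> = c b" using A by (simp add: finsum_singleton)
    finally show ?thesis by simp
  qed
  then have "left_basis R ?F ?E" using EF span unfolding left_basis_def by blast
  then show ?thesis using row_module_left_module unfolding free_left_module_def by blast
qed

text \<open>
  The submodule \<open>N\<close> can be large: only the restriction of \<open>f\<close> to the span of \<open>A\<close> is extended, which
  is why the extension agrees with \<open>f\<close> on \<open>A\<close> alone.
\<close>

lemma left_fp_injective_extend:
  fixes n
  defines "F \<equiv> row_module R n :: ('a, ('a, 'm) module_universe) module"
  assumes fp: "left_fp_injective TYPE(('a, 'm) module_universe) R"
    and N: "submodule N R F" and f: "f \<in> left_hom R (F\<lparr>carrier := N\<rparr>) (left_regular R)"
    and A: "finite A" "A \<subseteq> N"
  obtains g where "g \<in> left_hom R F (left_regular R)" "\<And>p. p \<in> A \<Longrightarrow> g p = f p"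
proof -
  interpret F: left_module R F unfolding F_def by (rule row_module_left_module)
  let ?S = "left_span R F A"
  have SN: "?S \<subseteq> N" using N A unfolding left_span_def by blast
  have AS: "A \<subseteq> ?S" unfolding left_span_def by blast
  have "A \<subseteq> carrier F" using A N by (auto simp: F.submodule_iff)
  then have "fg_submodule R F ?S" using A(1) unfolding fg_submodule_def by (intro exI[of _ A]) simp
  moreover have "f \<in> left_hom R (F\<lparr>carrier := ?S\<rparr>) (left_regular R)"
    using f SN by (auto simp: left_hom_def subset_iff Pi_def)
  ultimately obtain g where "g \<in> left_hom R F (left_regular R)" "\<forall>x\<in>?S. g x = f x"
    using fp row_module_free unfolding left_fp_injective_def F_def by metis
  then show ?thesis using that AS by blast
qed

end

section \<open>Weak injectivity conditions\<close>

text \<open>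
  Self-injectivity tested on left ideals, where an extension to the ring is the right multiplication
  by the image of \<open>1\<close>. No modules are mentioned, so there is no dependence on a type of module elements.
\<close>

definition left_baer :: "('a, 'r) ring_scheme \<Rightarrow> bool" where
  "left_baer R \<longleftrightarrow> (\<forall>I f. left_ideal I R \<and> f \<in> ideal_homs R I \<longrightarrow>
     (\<exists>w\<in>carrier R. \<forall>x\<in>I. f x = x \<otimes>\<^bsub>R\<^esub> w))"

text \<open>
  Equivalently, homomorphisms from finitely generated left ideals to the ring extend to the ring. The
  finite set takes the place of a generating set.
\<close>

definition left_f_injective :: "('a, 'r) ring_scheme \<Rightarrow> bool" where
  "left_f_injective R \<longleftrightarrow> (\<forall>I f K. left_ideal I R \<and> f \<in> ideal_homs R I \<and> finite K \<and> K \<subseteq> I \<longrightarrow>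
     (\<exists>w\<in>carrier R. \<forall>x\<in>K. f x = x \<otimes>\<^bsub>R\<^esub> w))"

text \<open>
  A homomorphism from \<open>Ra\<close> to the ring with \<open>a \<mapsto> x\<close> exists exactly when \<open>l a \<subseteq> l x\<close>, and it extends to
  the ring exactly when \<open>x \<in> aR\<close>.
\<close>

definition left_p_injective :: "('a, 'r) ring_scheme \<Rightarrow> bool" where
  "left_p_injective R \<longleftrightarrow> (\<forall>a\<in>carrier R. \<forall>x\<in>carrier R.
     left_ann R {a} \<subseteq> left_ann R {x} \<longrightarrow> (\<exists>s\<in>carrier R. x = a \<otimes>\<^bsub>R\<^esub> s))"

lemma left_homD:
  assumes "f \<in> left_hom R M N"
  shows "\<And>x. x \<in> carrier M \<Longrightarrow> f x \<in> carrier N"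
    "\<And>x y. \<lbrakk>x \<in> carrier M; y \<in> carrier M\<rbrakk> \<Longrightarrow> f (x \<oplus>\<^bsub>M\<^esub> y) = f x \<oplus>\<^bsub>N\<^esub> f y"
    "\<And>a x. \<lbrakk>a \<in> carrier R; x \<in> carrier M\<rbrakk> \<Longrightarrow> f (a \<odot>\<^bsub>M\<^esub> x) = a \<odot>\<^bsub>N\<^esub> f x"
  using assms by (auto simp: left_hom_def)

lemma factor_through:
  assumes "\<And>x y. \<lbrakk>x \<in> A; y \<in> A; \<phi> x = \<phi> y\<rbrakk> \<Longrightarrow> \<psi> x = \<psi> y"
  shows "\<exists>f. \<forall>x\<in>A. f (\<phi> x) = \<psi> x"
proof (intro exI ballI)
  fix x assume "x \<in> A"
  then show "(\<psi> \<circ> inv_into A \<phi>) (\<phi> x) = \<psi> x"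
    using assms by (metis comp_apply f_inv_into_f imageI inv_into_into)
qed

context ring
begin

abbreviation single_row :: "'a \<Rightarrow> ('a, 'm) module_universe" where
  "single_row a \<equiv> Inl (\<lambda>i. if i = 0 then a else \<zero>)"

lemma single_row_submodule:
  defines "F \<equiv> row_module R (Suc 0) :: ('a, ('a, 'm) module_universe) module"
  assumes I: "left_ideal I R" and f: "f \<in> ideal_homs R I"
  shows "submodule (single_row ` I) R F"
    and "(\<lambda>p. f (projl p 0)) \<in> left_hom R (F\<lparr>carrier := single_row ` I\<rparr>) (left_regular R)"
proof -
  interpret F: left_module R F unfolding F_def by (rule row_module_left_module)
  note I = left_idealD[OF I]
  have F_add: "single_row a \<oplus>\<^bsub>F\<^esub> single_row b = single_row (a \<oplus> b)"
    if "a \<in> I" "b \<in> I" for a b by (auto simp: F_def)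
  have F_smult: "r \<odot>\<^bsub>F\<^esub> single_row a = single_row (r \<otimes> a)"
    if "a \<in> I" "r \<in> carrier R" for a r
    using that by (auto simp: F_def)
  have F_zero: "\<zero>\<^bsub>F\<^esub> = single_row \<zero>" by (simp add: F_def)
  have sub: "single_row ` I \<subseteq> carrier F" using I by (auto simp: F_def row_module_carrier)
  show "submodule (single_row ` I) R F"
    unfolding F.submodule_iff
  proof (intro conjI ballI sub)
    show "\<zero>\<^bsub>F\<^esub> \<in> single_row ` I" unfolding F_zero using I(3) by (rule imageI)
    show "p \<oplus>\<^bsub>F\<^esub> q \<in> single_row ` I" if "p \<in> single_row ` I" "q \<in> single_row ` I" for p q
    proof -
      obtain a b where "a \<in> I" "b \<in> I" "p = single_row a" "q = single_row b" using \<open>p \<in> _\<close> \<open>q \<in> _\<close> by blast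
      then show ?thesis using I(4) F_add by simp
    qed
    show "r \<odot>\<^bsub>F\<^esub> p \<in> single_row ` I" if "r \<in> carrier R" "p \<in> single_row ` I" for r p
    proof -
      obtain a where "a \<in> I" "p = single_row a" using \<open>p \<in> _\<close> by blast
      then show ?thesis using I(5) F_smult \<open>r \<in> _\<close> by simp
    qed
  qed
  show "(\<lambda>p. f (projl p 0)) \<in> left_hom R (F\<lparr>carrier := single_row ` I\<rparr>) (left_regular R)"
    using left_homD[OF f, simplified] I by (auto simp: left_hom_def F_add F_smult simp del: row_module_simps)
qed

lemma row_hom_single_row:
  assumes "g \<in> left_hom R (row_module R (Suc 0) :: ('a, ('a, 'm) module_universe) module) (left_regular R)"
    and "a \<in> carrier R"
  shows "g (single_row a) = a \<otimes> g (unit_row R 0)" "g (unit_row R 0) \<in> carrier R"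
proof -
  let ?F = "row_module R (Suc 0) :: ('a, ('a, 'm) module_universe) module"
  have u: "unit_row R 0 \<in> carrier ?F" by (rule unit_row_closed) simp
  have "single_row a = a \<odot>\<^bsub>?F\<^esub> unit_row R 0"
    using assms(2) by (auto simp: unit_row_def)
  then show "g (single_row a) = a \<otimes> g (unit_row R 0)" using left_homD(3)[OF assms(1,2) u] by simp
  show "g (unit_row R 0) \<in> carrier R" using left_homD(1)[OF assms(1) u] by simp
qed

lemma left_fp_injective_imp_f_injective:
  assumes fp: "left_fp_injective TYPE(('a, 'm) module_universe) R"
  shows "left_f_injective R"
  unfolding left_f_injective_def
proof (intro allI impI, elim conjE)
  fix I f K assume I: "left_ideal I R" and f: "f \<in> ideal_homs R I" and K: "finite K" "K \<subseteq> I"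
  obtain g where g: "g \<in> left_hom R (row_module R (Suc 0) :: ('a, ('a, 'm) module_universe) module) (left_regular R)"
    "\<And>p. p \<in> single_row ` K \<Longrightarrow> g p = f (projl p 0)"
    using left_fp_injective_extend[OF fp single_row_submodule[OF I f], of "single_row ` K"] K by auto
  have "f x = x \<otimes> g (unit_row R 0)" if "x \<in> K" for x
    using row_hom_single_row(1)[OF g(1), of x] g(2)[of "single_row x"] that K(2) left_idealD(2)[OF I]
    by auto
  then show "\<exists>w\<in>carrier R. \<forall>x\<in>K. f x = x \<otimes> w" using row_hom_single_row(2)[OF g(1)] by blast
qed

lemma left_self_injective_imp_baer:
  assumes inj: "left_self_injective TYPE(('a, 'm) module_universe) R"
  shows "left_baer R"
  unfolding left_baer_def
proof (intro allI impI, elim conjE)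
  fix I f assume I: "left_ideal I R" and f: "f \<in> ideal_homs R I"
  obtain g where g: "g \<in> left_hom R (row_module R (Suc 0) :: ('a, ('a, 'm) module_universe) module) (left_regular R)"
    "\<forall>p\<in>single_row ` I. g p = f (projl p 0)"
    using inj[unfolded left_self_injective_def, rule_format, OF conjI[OF row_module_left_module
      conjI[OF single_row_submodule[OF I f]]]] by blast
  have "f x = x \<otimes> g (unit_row R 0)" if "x \<in> I" for x
    using row_hom_single_row(1)[OF g(1), of x] bspec[OF g(2), of "single_row x"] that left_idealD(2)[OF I]
    by auto
  then show "\<exists>w\<in>carrier R. \<forall>x\<in>I. f x = x \<otimes> w" using row_hom_single_row(2)[OF g(1)] by blast
qed

text \<open>
  The hypothesis on annihilators makes \<open>r v \<mapsto> r x\<close> well defined on the cyclic module generated by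
  the row \<open>v\<close> that lists \<open>A\<close>. The values of an extension at the unit rows are coefficients that write \<open>x\<close>
  as a right linear combination of \<open>A\<close>.
\<close>

lemma left_fp_injective_ann_finite:
  assumes fp: "left_fp_injective TYPE(('a, 'm) module_universe) R"
    and T: "right_ideal T R" and A: "finite A" "A \<subseteq> T"
    and x: "x \<in> carrier R" "left_ann R A \<subseteq> left_ann R {x}"
  shows "x \<in> T"
proof -
  note T = right_idealD[OF T]
  obtain a :: "nat \<Rightarrow> 'a" and n where a: "A = a ` {i. i < n}"
    using A(1) finite_imp_nat_seg_image_inj_on by metis
  define v where "v i = (if i < n then a i else \<zero>)" for i
  have vT: "v i \<in> T" for i using A a T(3) by (auto simp: v_def)
  have vc: "v i \<in> carrier R" for i using vT T(2) by blast
  define F where "F = (row_module R n :: ('a, ('a, 'm) module_universe) module)"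
  define e :: "('a, 'm) module_universe" where "e = Inl v"
  interpret F: left_module R F unfolding F_def by (rule row_module_left_module)
  have eF: "e \<in> carrier F" using vc by (auto simp: row_module_carrier v_def F_def e_def)
  have "r \<otimes> x = s \<otimes> x"
    if rs: "r \<in> carrier R" "s \<in> carrier R" "r \<odot>\<^bsub>F\<^esub> e = s \<odot>\<^bsub>F\<^esub> e" for r s
  proof -
    have "r \<otimes> v i = s \<otimes> v i" for i using rs(3) by (simp add: fun_eq_iff F_def e_def)
    then have "(r \<ominus> s) \<otimes> v i = \<zero>" for i
      using rs vc by (simp add: minus_eq l_distr l_minus r_neg)
    moreover have "\<exists>i. y = v i" if "y \<in> A" for y using that unfolding a v_def by force
    ultimately have "r \<ominus> s \<in> left_ann R A"
      using rs unfolding left_ann_def by auto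
    then have "(r \<ominus> s) \<otimes> x = \<zero>" using x(2) by (auto simp: left_ann_def)
    then have "r \<otimes> x \<ominus> s \<otimes> x = \<zero>" using rs x(1) by (simp add: minus_eq l_distr l_minus)
    then show ?thesis using rs x(1) by (metis r_right_minus_eq m_closed)
  qed
  then have "\<exists>f. \<forall>r\<in>carrier R. f (r \<odot>\<^bsub>F\<^esub> e) = r \<otimes> x" by (rule factor_through)
  then obtain f where f: "\<And>r. r \<in> carrier R \<Longrightarrow> f (r \<odot>\<^bsub>F\<^esub> e) = r \<otimes> x" by blast
  define N where "N = {r \<odot>\<^bsub>F\<^esub> e |r. r \<in> carrier R}"
  have NI: "r \<odot>\<^bsub>F\<^esub> e \<in> N" if "r \<in> carrier R" for r using that by (auto simp: N_def)
  have NE: "\<exists>r\<in>carrier R. p = r \<odot>\<^bsub>F\<^esub> e" if "p \<in> N" for p using that by (auto simp: N_def)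
  have N_add: "r \<odot>\<^bsub>F\<^esub> e \<oplus>\<^bsub>F\<^esub> s \<odot>\<^bsub>F\<^esub> e = (r \<oplus> s) \<odot>\<^bsub>F\<^esub> e"
    and N_smult: "r \<odot>\<^bsub>F\<^esub> (s \<odot>\<^bsub>F\<^esub> e) = (r \<otimes> s) \<odot>\<^bsub>F\<^esub> e"
    if "r \<in> carrier R" "s \<in> carrier R" for r s
    using F.smult_l_distr[OF that eF] F.smult_assoc[OF that eF] by simp_all
  have eN: "e \<in> N" using NI[of \<one>] eF by simp
  have "submodule N R F"
    unfolding F.submodule_iff
  proof (intro conjI ballI)
    show "N \<subseteq> carrier F" using eF NE by auto
    show "\<zero>\<^bsub>F\<^esub> \<in> N" using F.smult_l_zero[OF eF] NI[of \<zero>] by simp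
    show "p \<oplus>\<^bsub>F\<^esub> q \<in> N" if "p \<in> N" "q \<in> N" for p q
      using NE[OF that(1)] NE[OF that(2)] by (auto simp: N_add NI)
    show "r \<odot>\<^bsub>F\<^esub> p \<in> N" if "r \<in> carrier R" "p \<in> N" for r p
      using NE[OF that(2)] that(1) by (auto simp: N_smult NI)
  qed
  moreover have "f \<in> left_hom R (F\<lparr>carrier := N\<rparr>) (left_regular R)"
    using x(1) by (auto simp: left_hom_def f N_add N_smult l_distr m_assoc dest!: NE)
  ultimately obtain g where g: "g \<in> left_hom R F (left_regular R)" "g e = f e"
    using left_fp_injective_extend[OF fp, of N n f "{e}"] eN unfolding F_def by blast
  have "g (Inl v) \<in> T"
  proof (rule row_induct[where P = "\<lambda>p. g p \<in> T" and n = n, folded F_def])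
    show "Inl v \<in> carrier F" using eF by (simp add: e_def)
    have "g \<zero>\<^bsub>F\<^esub> = g (\<zero> \<odot>\<^bsub>F\<^esub> \<zero>\<^bsub>F\<^esub>)" using F.smult_l_zero[of "\<zero>\<^bsub>F\<^esub>"] by simp
    also have "\<dots> = \<zero> \<otimes> g \<zero>\<^bsub>F\<^esub>" using left_homD(3)[OF g(1) zero_closed F.M.zero_closed] by simp
    also have "\<dots> = \<zero>" using left_homD(1)[OF g(1) F.M.zero_closed] by simp
    finally show "g \<zero>\<^bsub>F\<^esub> \<in> T" using T(3) by simp
    fix k p assume k: "k < n" "p \<in> carrier F" "g p \<in> T"
    have u: "unit_row R k \<in> carrier F" unfolding F_def using k unit_row_closed by blast
    then have gu: "g (unit_row R k) \<in> carrier R" using left_homD(1)[OF g(1)] by simp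
    have "g (p \<oplus>\<^bsub>F\<^esub> v k \<odot>\<^bsub>F\<^esub> unit_row R k) = g p \<oplus> v k \<otimes> g (unit_row R k)"
      using left_homD(2)[OF g(1) k(2) F.smult_closed[OF vc u]] left_homD(3)[OF g(1) vc u] by simp
    then show "g (p \<oplus>\<^bsub>F\<^esub> v k \<odot>\<^bsub>F\<^esub> unit_row R k) \<in> T"
      using k(3) vT[of k] gu T(4,5) by simp
  qed
  moreover have "f e = x" using f[of \<one>] x(1) eF by simp
  ultimately show ?thesis using g(2) by (simp add: e_def)
qed

text \<open>
  Among the right ideals \<open>r (l A)\<close> with \<open>A\<close> a finite subset of \<open>T\<close> there is a maximal one. Adding an
  element of \<open>T\<close> to its \<open>A\<close> changes nothing, so it contains \<open>T\<close>, whence \<open>l A = l T\<close>.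
\<close>

lemma right_ideal_annihilator:
  assumes fp: "left_fp_injective TYPE(('a, 'm) module_universe) R"
    and noeth: "right_noetherian R" and T: "right_ideal T R"
  shows "right_ann R (left_ann R T) = T"
proof -
  note T' = right_idealD[OF T]
  let ?\<F> = "{right_ann R (left_ann R A) |A. finite A \<and> A \<subseteq> T}"
  have "right_ideal I R" if "I \<in> ?\<F>" for I
  proof -
    obtain A where "I = right_ann R (left_ann R A)" using \<open>I \<in> ?\<F>\<close> by blast
    moreover have "left_ann R A \<subseteq> carrier R" by (auto simp: left_ann_def)
    ultimately show ?thesis using right_ideal_right_ann by blast
  qed
  moreover have "?\<F> \<noteq> {}" by blast
  ultimately have "\<exists>M\<in>?\<F>. \<forall>I\<in>?\<F>. M \<subseteq> I \<longrightarrow> I = M"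
    using right_noetherian_maximal[OF noeth] by meson
  then obtain M where M: "M \<in> ?\<F>" "\<And>I. \<lbrakk>I \<in> ?\<F>; M \<subseteq> I\<rbrakk> \<Longrightarrow> I = M" by meson
  obtain A where A: "finite A" "A \<subseteq> T" "M = right_ann R (left_ann R A)" using M(1) by blast
  have AT: "left_ann R A \<subseteq> left_ann R T"
  proof
    fix y assume y: "y \<in> left_ann R A"
    have "y \<otimes> t = \<zero>" if t: "t \<in> T" for t
    proof -
      have "right_ann R (left_ann R (insert t A)) = M"
      proof (rule M(2))
        have "finite (insert t A)" "insert t A \<subseteq> T" using A t by auto
        then show "right_ann R (left_ann R (insert t A)) \<in> ?\<F>" by blast
        show "M \<subseteq> right_ann R (left_ann R (insert t A))" unfolding A(3) by (auto simp: left_ann_def)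
      qed
      moreover have "t \<in> right_ann R (left_ann R (insert t A))" using t T'(2) by (auto simp: left_ann_def)
      ultimately show ?thesis using y A(3) by (auto simp: left_ann_def)
    qed
    then show "y \<in> left_ann R T" using y by (auto simp: left_ann_def)
  qed
  show ?thesis
  proof
    show "T \<subseteq> right_ann R (left_ann R T)" using T'(2) by (auto simp: left_ann_def)
    show "right_ann R (left_ann R T) \<subseteq> T"
    proof
      fix x assume x: "x \<in> right_ann R (left_ann R T)"
      show "x \<in> T"
        by (rule left_fp_injective_ann_finite[OF fp T A(1,2)]) (use x AT in \<open>auto simp: left_ann_def\<close>)
    qed
  qed
qed


text \<open>The inclusion \<open>l a \<subseteq> l x\<close> places \<open>x\<close> in \<open>r (l (aR)) = aR\<close>.\<close>

lemma annihilator_imp_p_injective: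
  assumes "\<And>T. right_ideal T R \<Longrightarrow> right_ann R (left_ann R T) = T"
  shows "left_p_injective R"
  unfolding left_p_injective_def
proof (intro ballI impI)
  fix a x assume ax: "a \<in> carrier R" "x \<in> carrier R" "left_ann R {a} \<subseteq> left_ann R {x}"
  let ?T = "PIdl\<^bsub>opposite R\<^esub> a"
  have "a \<in> ?T" using ring.principal_self[OF opposite_ring] ax by simp
  then have "x \<in> right_ann R (left_ann R ?T)"
    using ax by (auto simp: left_ann_def)
  then have "x \<in> ?T" using assms[OF right_ideal_principal[OF ax(1)]] by simp
  then show "\<exists>s\<in>carrier R. x = a \<otimes> s" by (auto simp: right_principal_def)
qed

text \<open>
  The assignment \<open>\<phi> t \<mapsto> \<psi> t\<close> is a well-defined homomorphism on the image of \<open>\<phi>\<close>, hence a right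
  multiplication.
\<close>

lemma left_baer_factor:
  assumes baer: "left_baer R" and T: "left_ideal T R"
    and \<phi>: "\<phi> \<in> ideal_homs R T" and \<psi>: "\<psi> \<in> ideal_homs R T"
    and ker: "\<And>t. \<lbrakk>t \<in> T; \<phi> t = \<zero>\<rbrakk> \<Longrightarrow> \<psi> t = \<zero>"
  shows "\<exists>s\<in>carrier R. \<forall>t\<in>T. \<psi> t = \<phi> t \<otimes> s"
proof -
  note T' = left_idealD[OF T]
  have hom_minus: "h (x \<ominus> y) = h x \<ominus> h y" if "h \<in> ideal_homs R T" "x \<in> T" "y \<in> T" for h x y
  proof -
    have "h (x \<ominus> y) = h (x \<oplus> \<ominus> \<one> \<otimes> y)" using that T'(2) by (simp add: minus_eq l_minus)
    also have "\<dots> = h x \<oplus> \<ominus> \<one> \<otimes> h y" using that T'(5) by (simp add: ideal_homs_iff)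
    also have "\<dots> = h x \<ominus> h y" using that by (auto simp: ideal_homs_iff minus_eq l_minus Pi_def)
    finally show ?thesis .
  qed
  have \<phi>c: "\<phi> t \<in> carrier R" and \<psi>c: "\<psi> t \<in> carrier R" if "t \<in> T" for t
    using that \<phi> \<psi> by (auto simp: ideal_homs_iff)
  have "\<psi> x = \<psi> y" if xy: "x \<in> T" "y \<in> T" "\<phi> x = \<phi> y" for x y
  proof -
    have "\<psi> (x \<ominus> y) = \<zero>"
    proof (rule ker)
      show "\<phi> (x \<ominus> y) = \<zero>" using hom_minus[OF \<phi>] xy \<phi>c by (simp add: r_right_minus_eq)
    qed (use xy T'(7) in auto)
    then show ?thesis using hom_minus[OF \<psi>] xy \<psi>c by (simp add: r_right_minus_eq)
  qed
  then have "\<exists>f. \<forall>t\<in>T. f (\<phi> t) = \<psi> t" by (rule factor_through)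
  then obtain f where f: "\<And>t. t \<in> T \<Longrightarrow> f (\<phi> t) = \<psi> t" by blast
  have add: "\<phi> x \<oplus> \<phi> y = \<phi> (x \<oplus> y)" "\<psi> x \<oplus> \<psi> y = \<psi> (x \<oplus> y)" if "x \<in> T" "y \<in> T" for x y
    using that \<phi> \<psi> by (simp_all add: ideal_homs_iff)
  have mult: "r \<otimes> \<phi> x = \<phi> (r \<otimes> x)" "r \<otimes> \<psi> x = \<psi> (r \<otimes> x)" if "r \<in> carrier R" "x \<in> T" for r x
    using that \<phi> \<psi> by (simp_all add: ideal_homs_iff)
  have "\<phi> \<zero> = \<zero>" using mult(1)[of \<zero> \<zero>] T'(3) \<phi>c by simp
  have "left_ideal (\<phi> ` T) R"
  proof (rule left_idealI)
    show "\<phi> ` T \<subseteq> carrier R" using \<phi>c by blast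
    show "\<zero> \<in> \<phi> ` T" using \<open>\<phi> \<zero> = \<zero>\<close> T'(3) by (metis imageI)
    show "a \<oplus> b \<in> \<phi> ` T" if "a \<in> \<phi> ` T" "b \<in> \<phi> ` T" for a b
      using that T'(4) by (auto simp: add)
    show "r \<otimes> a \<in> \<phi> ` T" if "r \<in> carrier R" "a \<in> \<phi> ` T" for r a
      using that T'(5) by (auto simp: mult)
  qed
  moreover have "f \<in> ideal_homs R (\<phi> ` T)"
    using T'(4,5) \<psi>c by (auto simp: ideal_homs_iff add mult f)
  ultimately obtain s where "s \<in> carrier R" "\<forall>x\<in>\<phi> ` T. f x = x \<otimes> s"
    using baer unfolding left_baer_def by blast
  then show ?thesis using f by auto
qed

lemma right_mult_ideal_hom:
  assumes "left_ideal T R" "a \<in> carrier R"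
  shows "(\<lambda>t. t \<otimes> a) \<in> ideal_homs R T"
  using left_idealD(2)[OF assms(1)] assms(2) by (auto simp: ideal_homs_iff l_distr m_assoc)

lemma left_baer_imp_p_injective:
  assumes "left_baer R"
  shows "left_p_injective R"
  unfolding left_p_injective_def
proof (intro ballI impI)
  fix a x assume ax: "a \<in> carrier R" "x \<in> carrier R" "left_ann R {a} \<subseteq> left_ann R {x}"
  have "r \<otimes> x = \<zero>" if "r \<in> carrier R" "r \<otimes> a = \<zero>" for r
    using that ax(3) by (auto simp: left_ann_def)
  then have "\<exists>s\<in>carrier R. \<forall>r\<in>carrier R. r \<otimes> x = r \<otimes> a \<otimes> s"
    by (rule left_baer_factor[OF assms left_ideal_carrier right_mult_ideal_hom[OF left_ideal_carrier ax(1)]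
      right_mult_ideal_hom[OF left_ideal_carrier ax(2)]])
  then show "\<exists>s\<in>carrier R. x = a \<otimes> s" using ax by (metis l_one one_closed)
qed

lemma left_ideal_projection:
  assumes A: "left_ideal A R" and B: "left_ideal B R" and disj: "A \<inter> B = {\<zero>}"
  shows "\<exists>f\<in>ideal_homs R (A <+>\<^bsub>R\<^esub> B). (\<forall>a\<in>A. f a = a) \<and> (\<forall>b\<in>B. f b = \<zero>)"
proof -
  note A' = left_idealD[OF A] and B' = left_idealD[OF B]
  have "fst p = fst q" if pq: "p \<in> A \<times> B" "q \<in> A \<times> B" "fst p \<oplus> snd p = fst q \<oplus> snd q" for p q
  proof -
    obtain a b c d where p: "p = (a, b)" "q = (c, d)" "a \<in> A" "b \<in> B" "c \<in> A" "d \<in> B"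
      using pq by auto
    have eq: "a \<oplus> b = c \<oplus> d" using pq p by simp
    have "a \<ominus> c = d \<ominus> b"
    proof -
      have "a \<ominus> c = (a \<oplus> b) \<oplus> (\<ominus> c \<oplus> \<ominus> b)" using p A'(2) B'(2) by (simp add: minus_eq a_ac r_neg2)
      also have "\<dots> = (\<ominus> c \<oplus> c) \<oplus> (d \<oplus> \<ominus> b)" unfolding eq using p A'(2) B'(2) by (simp add: a_ac)
      also have "\<dots> = d \<ominus> b" using p A'(2) B'(2) by (simp add: minus_eq l_neg)
      finally show ?thesis .
    qed
    then have "a \<ominus> c \<in> A \<inter> B" using p A'(7) B'(7) by (metis IntI)
    then have "a \<ominus> c = \<zero>" using disj by blast
    then show ?thesis using p A'(2) by (simp add: r_right_minus_eq)
  qed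
  then have "\<exists>f. \<forall>p\<in>A \<times> B. f (fst p \<oplus> snd p) = fst p" by (rule factor_through)
  then obtain f where f: "\<And>p. p \<in> A \<times> B \<Longrightarrow> f (fst p \<oplus> snd p) = fst p" by blast
  have f': "f (a \<oplus> b) = a" if "a \<in> A" "b \<in> B" for a b using f[of "(a, b)"] that by simp
  show ?thesis
  proof (intro bexI[of _ f] conjI ballI)
    have "f ((a \<oplus> b) \<oplus> (c \<oplus> d)) = a \<oplus> c" if "a \<in> A" "b \<in> B" "c \<in> A" "d \<in> B" for a b c d
    proof -
      have "(a \<oplus> b) \<oplus> (c \<oplus> d) = (a \<oplus> c) \<oplus> (b \<oplus> d)" using that A'(2) B'(2) by (simp add: a_ac)
      then show ?thesis using f' that A'(4) B'(4) by simp
    qed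
    moreover have "f (r \<otimes> (a \<oplus> b)) = r \<otimes> a" if "r \<in> carrier R" "a \<in> A" "b \<in> B" for r a b
      using that A' B' by (simp add: r_distr f')
    ultimately show "f \<in> ideal_homs R (A <+>\<^bsub>R\<^esub> B)"
      using A'(2) f' by (auto simp: ideal_homs_iff set_add_def')
    show "f a = a" if "a \<in> A" for a using f'[of a \<zero>] that A' B' by simp
    show "f b = \<zero>" if "b \<in> B" for b using f'[of \<zero> b] that A' B' by simp
  qed
qed

text \<open>
  If \<open>Ra \<inter> Rb = 0\<close>, the projection of \<open>Ra + Rb\<close> to \<open>Ra\<close> agrees at \<open>a\<close> and \<open>b\<close> with the right
  multiplication by some \<open>w\<close>. Then \<open>bw = 0\<close>, so \<open>aw = 0\<close> by the hypothesis on annihilators, although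
  \<open>aw = a\<close>.
\<close>

lemma f_injective_common_multiple:
  assumes inj: "left_f_injective R" and ab: "a \<in> carrier R" "b \<in> carrier R" "a \<noteq> \<zero>"
    and ann: "right_ann R {b} \<subseteq> right_ann R {a}"
  shows "\<exists>r\<in>carrier R. \<exists>s\<in>carrier R. r \<otimes> a = s \<otimes> b \<and> r \<otimes> a \<noteq> \<zero>"
proof (rule ccontr)
  assume none: "\<not> ?thesis"
  note A = left_ideal_principal[OF ab(1)] and B = left_ideal_principal[OF ab(2)]
  have "x = \<zero>" if "x \<in> PIdl a" "x \<in> PIdl b" for x
    using that none by (auto simp: cgenideal_def)
  then have disj: "PIdl a \<inter> PIdl b = {\<zero>}"
    using left_idealD(3)[OF A] left_idealD(3)[OF B] by blast
  obtain f where f: "f \<in> ideal_homs R (PIdl a <+>\<^bsub>R\<^esub> PIdl b)" "f a = a" "f b = \<zero>"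
    using left_ideal_projection[OF A B disj] principal_self[OF ab(1)] principal_self[OF ab(2)] by auto
  have "{a, b} \<subseteq> PIdl a <+>\<^bsub>R\<^esub> PIdl b"
    using left_ideal_sum(2,3)[OF A B] principal_self[OF ab(1)] principal_self[OF ab(2)] by blast
  then have "\<exists>w\<in>carrier R. \<forall>x\<in>{a, b}. f x = x \<otimes> w"
    using inj[unfolded left_f_injective_def, rule_format, of _ f "{a, b}"] f(1) left_ideal_sum(1)[OF A B]
    by simp
  then obtain w where w: "w \<in> carrier R" "a \<otimes> w = a" "b \<otimes> w = \<zero>"
    using f(2,3) by force
  then have "w \<in> right_ann R {b}" by (simp add: left_ann_def)
  then have "a \<otimes> w = \<zero>" using ann by (auto simp: left_ann_def)
  then show False using w ab by simp
qed

end

section \<open>The left singular ideal\<close>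

text \<open>The elements whose left annihilator is an essential left ideal.\<close>

definition left_singular :: "('a, 'r) ring_scheme \<Rightarrow> 'a set" where
  "left_singular R = {x \<in> carrier R. \<forall>y\<in>carrier R. y \<noteq> \<zero>\<^bsub>R\<^esub> \<longrightarrow>
     (\<exists>r\<in>carrier R. r \<otimes>\<^bsub>R\<^esub> y \<noteq> \<zero>\<^bsub>R\<^esub> \<and> r \<otimes>\<^bsub>R\<^esub> y \<otimes>\<^bsub>R\<^esub> x = \<zero>\<^bsub>R\<^esub>)}"

context ring
begin

lemma left_singularI:
  assumes "x \<in> carrier R"
    and "\<And>y. \<lbrakk>y \<in> carrier R; y \<noteq> \<zero>\<rbrakk> \<Longrightarrow> \<exists>r\<in>carrier R. r \<otimes> y \<noteq> \<zero> \<and> r \<otimes> y \<otimes> x = \<zero>"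
  shows "x \<in> left_singular R"
  using assms by (simp add: left_singular_def)

lemma left_singularE:
  assumes "x \<in> left_singular R" "y \<in> carrier R" "y \<noteq> \<zero>"
  obtains r where "r \<in> carrier R" "r \<otimes> y \<noteq> \<zero>" "r \<otimes> y \<otimes> x = \<zero>"
  using assms by (auto simp: left_singular_def)

lemma left_singular_closed: "x \<in> left_singular R \<Longrightarrow> x \<in> carrier R"
  by (simp add: left_singular_def)

lemma not_left_singular:
  assumes "x \<in> carrier R" "x \<notin> left_singular R"
  shows "\<exists>y\<in>carrier R. y \<noteq> \<zero> \<and> (\<forall>r\<in>carrier R. r \<otimes> y \<otimes> x = \<zero> \<longrightarrow> r \<otimes> y = \<zero>)"
  using assms by (auto simp: left_singular_def)

lemma left_singular_mult_right:
  assumes x: "x \<in> left_singular R" and a: "a \<in> carrier R"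
  shows "x \<otimes> a \<in> left_singular R"
proof (rule left_singularI)
  note xc = left_singular_closed[OF x]
  show "x \<otimes> a \<in> carrier R" using xc a by simp
  fix y assume y: "y \<in> carrier R" "y \<noteq> \<zero>"
  obtain r where r: "r \<in> carrier R" "r \<otimes> y \<noteq> \<zero>" "r \<otimes> y \<otimes> x = \<zero>"
    using left_singularE[OF x y] .
  have "r \<otimes> y \<otimes> (x \<otimes> a) = (r \<otimes> y \<otimes> x) \<otimes> a" using r(1) xc a y by (simp add: m_assoc)
  then show "\<exists>r\<in>carrier R. r \<otimes> y \<noteq> \<zero> \<and> r \<otimes> y \<otimes> (x \<otimes> a) = \<zero>" using r a by auto
qed

lemma left_singular_left_ideal: "left_ideal (left_singular R) R"
proof (rule left_idealI)
  show "left_singular R \<subseteq> carrier R" using left_singular_closed by blast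
  show "\<zero> \<in> left_singular R"
    by (rule left_singularI) (auto intro!: bexI[of _ \<one>])
  show "a \<oplus> b \<in> left_singular R" if ab: "a \<in> left_singular R" "b \<in> left_singular R" for a b
  proof (rule left_singularI)
    note c = left_singular_closed[OF ab(1)] left_singular_closed[OF ab(2)]
    show "a \<oplus> b \<in> carrier R" using c by simp
    fix y assume y: "y \<in> carrier R" "y \<noteq> \<zero>"
    obtain r where r: "r \<in> carrier R" "r \<otimes> y \<noteq> \<zero>" "r \<otimes> y \<otimes> a = \<zero>"
      using left_singularE[OF ab(1) y] .
    obtain s where s: "s \<in> carrier R" "s \<otimes> (r \<otimes> y) \<noteq> \<zero>" "s \<otimes> (r \<otimes> y) \<otimes> b = \<zero>"
      using left_singularE[OF ab(2) _ r(2)] r(1) y(1) by blast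
    have "s \<otimes> (r \<otimes> y) \<otimes> a = s \<otimes> (r \<otimes> y \<otimes> a)" using r(1) s(1) y(1) c by (simp add: m_assoc)
    then have "(s \<otimes> r) \<otimes> y \<otimes> (a \<oplus> b) = \<zero>" "(s \<otimes> r) \<otimes> y \<noteq> \<zero>"
      using r s y(1) c by (simp_all add: m_assoc r_distr)
    then show "\<exists>r\<in>carrier R. r \<otimes> y \<noteq> \<zero> \<and> r \<otimes> y \<otimes> (a \<oplus> b) = \<zero>" using r(1) s(1) by blast
  qed
  show "a \<otimes> x \<in> left_singular R" if a: "a \<in> carrier R" and x: "x \<in> left_singular R" for a x
  proof (rule left_singularI)
    note xc = left_singular_closed[OF x]
    show "a \<otimes> x \<in> carrier R" using xc a by simp
    fix y assume y: "y \<in> carrier R" "y \<noteq> \<zero>"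
    show "\<exists>r\<in>carrier R. r \<otimes> y \<noteq> \<zero> \<and> r \<otimes> y \<otimes> (a \<otimes> x) = \<zero>"
    proof (cases "y \<otimes> a = \<zero>")
      case True
      then have "y \<otimes> (a \<otimes> x) = \<zero>" using y(1) a xc by (simp add: m_assoc[symmetric])
      then show ?thesis using y by (intro bexI[of _ \<one>]) auto
    next
      case False
      then obtain r where r: "r \<in> carrier R" "r \<otimes> (y \<otimes> a) \<noteq> \<zero>" "r \<otimes> (y \<otimes> a) \<otimes> x = \<zero>"
        using left_singularE[OF x, of "y \<otimes> a"] y(1) a by blast
      have "r \<otimes> (y \<otimes> a) = r \<otimes> y \<otimes> a" "r \<otimes> (y \<otimes> a) \<otimes> x = r \<otimes> y \<otimes> (a \<otimes> x)"
        using r(1) y(1) a xc by (simp_all add: m_assoc)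
      then have "r \<otimes> y \<noteq> \<zero>" "r \<otimes> y \<otimes> (a \<otimes> x) = \<zero>" using r a by auto
      then show ?thesis using r(1) by blast
    qed
  qed
qed

lemma right_singular_right_ideal: "right_ideal (left_singular (opposite R)) R"
  using ring.left_singular_left_ideal[OF opposite_ring] .

lemma left_p_injective_cancel:
  assumes inj: "left_p_injective R" and c: "y \<in> carrier R" "x \<in> carrier R"
    and "\<And>r. \<lbrakk>r \<in> carrier R; r \<otimes> y \<otimes> x = \<zero>\<rbrakk> \<Longrightarrow> r \<otimes> y = \<zero>"
  shows "\<exists>s\<in>carrier R. y = y \<otimes> x \<otimes> s"
proof -
  have "left_ann R {y \<otimes> x} \<subseteq> left_ann R {y}"
    using assms by (auto simp: left_ann_def m_assoc)
  then show ?thesis using inj c unfolding left_p_injective_def by simp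
qed

text \<open>
  The annihilators \<open>l w\<close> and \<open>l (1 - w)\<close> meet in \<open>0\<close>, and \<open>l w\<close> is essential, so \<open>l (1 - w) = 0\<close> and there is
  a right inverse \<open>t\<close>. Since \<open>t = 1 + wt\<close>, the same reasoning gives \<open>l t = 0\<close>, which makes \<open>t\<close> a two-sided
  inverse.
\<close>

lemma one_minus_singular_unit:
  assumes inj: "left_p_injective R" and w: "w \<in> left_singular R"
  obtains t where "t \<in> carrier R" "(\<one> \<ominus> w) \<otimes> t = \<one>" "t \<otimes> (\<one> \<ominus> w) = \<one>"
proof -
  note wc = left_singular_closed[OF w]
  have inj1: "v = \<zero>" if v: "v \<in> carrier R" "v \<otimes> (\<one> \<ominus> w) = \<zero>" for v
  proof (rule ccontr)
    assume "v \<noteq> \<zero>"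
    then obtain r where r: "r \<in> carrier R" "r \<otimes> v \<noteq> \<zero>" "r \<otimes> v \<otimes> w = \<zero>"
      using left_singularE[OF w v(1)] by blast
    have "v \<ominus> v \<otimes> w = \<zero>" using v wc by (simp add: minus_eq r_distr r_minus)
    then have "v = v \<otimes> w" using v wc by simp
    then have "r \<otimes> v = r \<otimes> v \<otimes> w" using r(1) v(1) wc by (metis m_assoc)
    then show False using r by simp
  qed
  obtain t where t: "t \<in> carrier R" "(\<one> \<ominus> w) \<otimes> t = \<one>"
  proof -
    have "\<exists>s\<in>carrier R. \<one> = \<one> \<otimes> (\<one> \<ominus> w) \<otimes> s"
    proof (rule left_p_injective_cancel[OF inj])
      show "r \<otimes> \<one> = \<zero>" if "r \<in> carrier R" "r \<otimes> \<one> \<otimes> (\<one> \<ominus> w) = \<zero>" for r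
        using that inj1 by simp
    qed (use wc in auto)
    then obtain s where "s \<in> carrier R" "\<one> = \<one> \<otimes> (\<one> \<ominus> w) \<otimes> s" by (elim bexE)
    then have "(\<one> \<ominus> w) \<otimes> s = \<one>" using wc by simp
    then show ?thesis using that \<open>s \<in> carrier R\<close> by blast
  qed
  have tw: "t = \<one> \<oplus> w \<otimes> t"
  proof -
    have "t \<ominus> w \<otimes> t = \<one>" using t wc by (simp add: minus_eq l_distr l_minus)
    then have "(t \<ominus> w \<otimes> t) \<oplus> w \<otimes> t = \<one> \<oplus> w \<otimes> t" by simp
    then show ?thesis using t(1) wc by (simp add: minus_eq a_assoc l_neg)
  qed
  have inj2: "v = \<zero>" if v: "v \<in> carrier R" "v \<otimes> t = \<zero>" for v
  proof (rule ccontr)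
    assume "v \<noteq> \<zero>"
    then obtain r where r: "r \<in> carrier R" "r \<otimes> v \<noteq> \<zero>" "r \<otimes> v \<otimes> w = \<zero>"
      using left_singularE[OF w v(1)] by blast
    have "\<zero> = r \<otimes> (v \<otimes> t)" using r v by simp
    also have "\<dots> = r \<otimes> v \<otimes> (\<one> \<oplus> w \<otimes> t)" using r(1) v(1) t(1) tw by (simp add: m_assoc)
    also have "\<dots> = r \<otimes> v \<oplus> (r \<otimes> v \<otimes> w) \<otimes> t" using r(1) v(1) t(1) wc by (simp add: m_assoc r_distr)
    also have "\<dots> = r \<otimes> v" using r v(1) t(1) by simp
    finally show False using r by simp
  qed
  have "(t \<otimes> (\<one> \<ominus> w) \<ominus> \<one>) \<otimes> t = t \<otimes> ((\<one> \<ominus> w) \<otimes> t) \<ominus> t"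
    using t(1) wc by (simp add: minus_eq l_distr l_minus m_assoc)
  also have "\<dots> = \<zero>" using t by simp
  finally have "t \<otimes> (\<one> \<ominus> w) \<ominus> \<one> = \<zero>" using inj2 t(1) wc by simp
  then have "t \<otimes> (\<one> \<ominus> w) = \<one>" using t(1) wc by simp
  then show ?thesis using that t by blast
qed

end

section \<open>Nilpotence of the singular ideal\<close>

context ring
begin

text \<open>
  Products without sums suffice because only annihilators and containments in right ideals are taken.
  The power \<open>0\<close> is the whole ring rather than \<open>{1}\<close>, so that all powers are closed under left
  multiplication.
\<close>

fun singular_power :: "nat \<Rightarrow> 'a set" where
  "singular_power 0 = carrier R"
| "singular_power (Suc n) = {p \<otimes> z |p z. p \<in> singular_power n \<and> z \<in> left_singular R}"

lemma singular_power_closed: "singular_power n \<subseteq> carrier R"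
  by (induction n) (use left_singular_closed in auto)

lemma singular_power_mult_left:
  assumes "r \<in> carrier R"
  shows "p \<in> singular_power n \<Longrightarrow> r \<otimes> p \<in> singular_power n"
proof (induction n arbitrary: p)
  case (Suc n)
  then obtain q z where qz: "p = q \<otimes> z" "q \<in> singular_power n" "z \<in> left_singular R" by auto
  then have "r \<otimes> p = (r \<otimes> q) \<otimes> z"
    using assms singular_power_closed[of n] left_singular_closed by (auto simp: m_assoc)
  then show ?case using Suc.IH[OF qz(2)] qz(3) by auto
qed (use assms in auto)

lemma singular_power_Suc_subset: "singular_power (Suc n) \<subseteq> singular_power n"
proof (cases n)
  case (Suc m)
  have "q \<otimes> y \<otimes> z \<in> singular_power (Suc m)"
    if "q \<in> singular_power m" "y \<in> left_singular R" "z \<in> left_singular R" for q y z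
  proof -
    have "q \<otimes> y \<otimes> z = q \<otimes> (y \<otimes> z)"
      using that singular_power_closed[of m] left_singular_closed by (auto simp: m_assoc)
    moreover have "y \<otimes> z \<in> left_singular R"
      using that left_singular_mult_right left_singular_closed by blast
    ultimately show ?thesis using that(1) by auto
  qed
  then show ?thesis unfolding Suc by auto
qed (use left_singular_closed in auto)

lemma pow_singular_power:
  assumes "z \<in> left_singular R"
  shows "z [^] n \<in> singular_power n"
proof (induction n)
  case (Suc n)
  then show ?case using assms by auto
qed simp

text \<open>
  Let \<open>Z\<close> be the singular ideal. The left annihilators of its powers are right ideals as well, so they
  become stationary, say at \<open>L = l (Z^m)\<close>. Put \<open>T = r L\<close>, which contains \<open>Z^m\<close>. If \<open>T \<noteq> 0\<close>, let \<open>M\<close> be maximal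
  among the right ideals properly contained in \<open>T\<close>. Then \<open>TZ \<subseteq> M\<close>, because \<open>1 - w\<close> is a unit for \<open>w\<close> in \<open>Z\<close>.
  So \<open>yM = 0\<close> implies \<open>y Z^(m+1) = 0\<close>, hence \<open>y \<in> L\<close> and \<open>yT = 0\<close>. This gives the contradiction
  \<open>T = r (l T) \<subseteq> r (l M) = M\<close>.
\<close>

lemma singular_power_nilpotent:
  assumes inj: "left_p_injective R" and noeth: "right_noetherian R"
    and ann: "\<And>T. right_ideal T R \<Longrightarrow> right_ann R (left_ann R T) = T"
  shows "\<exists>m. singular_power m \<subseteq> {\<zero>}"
proof -
  define L where "L n = left_ann R (singular_power n)" for n
  have L_right: "right_ideal (L n) R" for n
  proof (rule right_idealI)
    note P = singular_power_closed[of n]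
    show "L n \<subseteq> carrier R" by (auto simp: L_def left_ann_def)
    show "\<zero> \<in> L n" using P by (auto simp: L_def left_ann_def)
    show "a \<oplus> b \<in> L n" if "a \<in> L n" "b \<in> L n" for a b
      using that P by (auto simp: L_def left_ann_def l_distr subset_iff)
    show "a \<otimes> r \<in> L n" if "r \<in> carrier R" "a \<in> L n" for r a
      using that P singular_power_mult_left[OF that(1)]
      by (auto simp: L_def left_ann_def m_assoc subset_iff)
  qed
  have "L n \<subseteq> L (Suc n)" for n
    using singular_power_Suc_subset[of n] unfolding L_def left_ann_def by blast
  then have "\<exists>m. \<forall>n\<ge>m. L n = L m"
    using noeth[unfolded right_noetherian_def left_noetherian_def, rule_format, of L] L_right by blast
  then obtain m where m: "L (Suc m) = L m" by (metis le_Suc_eq order_refl)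
  define T where "T = right_ann R (L m)"
  have T: "right_ideal T R"
    unfolding T_def by (rule right_ideal_right_ann) (auto simp: L_def left_ann_def)
  note T' = right_idealD[OF T]
  have PT: "singular_power m \<subseteq> T"
    using singular_power_closed[of m] by (auto simp: T_def L_def left_ann_def)
  have "T = {\<zero>}"
  proof (rule ccontr)
    assume "T \<noteq> {\<zero>}"
    define F where "F = {I. right_ideal I R \<and> I \<subset> T}"
    have "{\<zero>} \<in> F" using \<open>T \<noteq> {\<zero>}\<close> T'(3) right_ideal_zero by (auto simp: F_def)
    then have "\<exists>M\<in>F. \<forall>I\<in>F. M \<subseteq> I \<longrightarrow> I = M"
      by (intro right_noetherian_maximal[OF noeth]) (auto simp: F_def)
    then obtain M where "M \<in> F" and M_max: "\<forall>I\<in>F. M \<subseteq> I \<longrightarrow> I = M" by (elim bexE)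
    then have M: "right_ideal M R" "M \<subset> T" by (simp_all add: F_def)
    have max: "I = M" if "right_ideal I R" "I \<subset> T" "M \<subseteq> I" for I
      using M_max that by (simp add: F_def)
    note M' = right_idealD[OF M(1)]
    have TZ: "t \<otimes> z \<in> M" if t: "t \<in> T" and z: "z \<in> left_singular R" for t z
    proof (rule ccontr)
      assume notin: "t \<otimes> z \<notin> M"
      have tc: "t \<in> carrier R" and zc: "z \<in> carrier R" using t T'(2) left_singular_closed[OF z] by auto
      let ?V = "M <+>\<^bsub>R\<^esub> PIdl\<^bsub>opposite R\<^esub> (t \<otimes> z)"
      have P: "right_ideal (PIdl\<^bsub>opposite R\<^esub> (t \<otimes> z)) R" using right_ideal_principal tc zc by simp
      have "t \<otimes> z \<in> ?V"
        using right_ideal_sum(3)[OF M(1) P] ring.principal_self[OF opposite_ring, of "t \<otimes> z"] tc zc by auto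
      moreover have "?V \<subseteq> T"
      proof
        fix v assume "v \<in> ?V"
        then obtain a r where v: "a \<in> M" "r \<in> carrier R" "v = a \<oplus> t \<otimes> z \<otimes> r"
          by (auto simp: set_add_def' right_principal_def)
        have "t \<otimes> z \<otimes> r \<in> T" using T'(5)[OF v(2) T'(5)[OF zc t]] .
        then show "v \<in> T" using T'(4) v(1,3) M(2) by auto
      qed
      ultimately have "?V = T"
        using max[OF right_ideal_sum(1)[OF M(1) P] _ right_ideal_sum(2)[OF M(1) P]] notin by auto
      then obtain a r where ar: "a \<in> M" "r \<in> carrier R" "t = a \<oplus> t \<otimes> z \<otimes> r"
        using t by (auto simp: set_add_def' right_principal_def)
      have ac: "a \<in> carrier R" using ar M'(2) by blast
      obtain s where s: "s \<in> carrier R" "(\<one> \<ominus> z \<otimes> r) \<otimes> s = \<one>"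
        by (rule one_minus_singular_unit[OF inj left_singular_mult_right[OF z ar(2)]])
      have "t \<ominus> t \<otimes> z \<otimes> r = a"
      proof -
        have "t \<ominus> t \<otimes> z \<otimes> r = (a \<oplus> t \<otimes> z \<otimes> r) \<ominus> t \<otimes> z \<otimes> r" using ar(3) by simp
        also have "\<dots> = a" using ac tc zc ar(2) by (simp add: minus_eq a_assoc r_neg)
        finally show ?thesis .
      qed
      then have "t \<otimes> (\<one> \<ominus> z \<otimes> r) = a" using tc zc ar(2) by (simp add: minus_eq r_distr r_minus m_assoc)
      moreover have "t = t \<otimes> (\<one> \<ominus> z \<otimes> r) \<otimes> s" using s tc zc ar(2) by (simp add: m_assoc)
      ultimately have "t \<in> M" using M'(5)[OF s(1) ar(1)] by simp
      then have "t \<otimes> z \<in> M" using M'(5)[OF zc] by simp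
      then show False using notin by simp
    qed
    have "left_ann R M \<subseteq> left_ann R T"
    proof
      fix y assume y: "y \<in> left_ann R M"
      then have yc: "y \<in> carrier R" by (simp add: left_ann_def)
      have "y \<otimes> (p \<otimes> z) = \<zero>" if "p \<in> singular_power m" "z \<in> left_singular R" for p z
        using y TZ[of p z] that PT by (auto simp: left_ann_def)
      then have "y \<in> L (Suc m)" using yc by (auto simp: L_def left_ann_def)
      then have "y \<in> L m" using m by simp
      then show "y \<in> left_ann R T" using yc by (auto simp: T_def left_ann_def)
    qed
    then have "right_ann R (left_ann R T) \<subseteq> right_ann R (left_ann R M)" by (auto simp: left_ann_def)
    then show False using ann[OF T] ann[OF M(1)] M(2) by simp
  qed
  then show ?thesis using PT by blast
qed

text \<open>
  Put \<open>w = 1 - u\<close>. Every power of \<open>w\<close> has the form \<open>1 - qu\<close> with \<open>q\<close> commuting with \<open>u\<close>, so that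
  \<open>u^m w^m = 0\<close> reads \<open>u^m = u^m (qu)\<close>, and this makes \<open>(qu)^m\<close> idempotent. An element with \<open>cu = c\<close>
  satisfies \<open>cw = 0\<close>, so it is fixed by \<open>qu\<close> too.
\<close>

lemma nilpotent_imp_idempotent:
  assumes u: "u \<in> carrier R" and nil: "(u \<ominus> u \<otimes> u) [^] (n::nat) = \<zero>"
  obtains q where "q \<in> carrier R" "q \<otimes> u = u \<otimes> q" "(q \<otimes> u) \<otimes> (q \<otimes> u) = q \<otimes> u"
    "\<And>c. \<lbrakk>c \<in> carrier R; c \<otimes> u = c\<rbrakk> \<Longrightarrow> c \<otimes> (q \<otimes> u) = c"
proof -
  define w where "w = \<one> \<ominus> u"
  \<comment> \<open>The exponent is positive so that the idempotent \<open>(qu)^m\<close> is a multiple of \<open>u\<close>.\<close>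
  define m where "m = Suc n"
  have wc: "w \<in> carrier R" using u by (simp add: w_def)
  have uw: "u \<otimes> w = u \<ominus> u \<otimes> u" "w \<otimes> u = u \<ominus> u \<otimes> u"
    using u by (simp_all add: w_def minus_eq r_distr l_distr r_minus l_minus)
  have "(u \<otimes> w) [^] m = \<zero>" using nil u wc by (simp add: uw m_def)
  then have uw0: "u [^] m \<otimes> w [^] m = \<zero>" using pow_mult_distrib[of u w m] uw u wc by simp
  have "\<exists>q\<in>carrier R. q \<otimes> u = u \<otimes> q \<and> w [^] k = \<one> \<ominus> q \<otimes> u" for k :: nat
  proof (induction k)
    case 0
    show ?case using u by (intro bexI[of _ \<zero>]) (auto simp: minus_eq)
  next
    case (Suc k)
    then obtain q where q: "q \<in> carrier R" "q \<otimes> u = u \<otimes> q" "w [^] k = \<one> \<ominus> q \<otimes> u" by blast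
    have quu: "q \<otimes> u \<otimes> u = u \<otimes> (q \<otimes> u)" using q(1,2) u m_assoc by metis
    have "w [^] Suc k = (\<one> \<ominus> q \<otimes> u) \<otimes> (\<one> \<ominus> u)" using q by (simp add: w_def)
    also have "\<dots> = \<one> \<ominus> (q \<oplus> \<one> \<ominus> q \<otimes> u) \<otimes> u"
      using q(1) u by (simp add: minus_eq l_distr r_distr l_minus r_minus minus_add a_ac)
    finally have "w [^] Suc k = \<one> \<ominus> (q \<oplus> \<one> \<ominus> q \<otimes> u) \<otimes> u" .
    moreover have "(q \<oplus> \<one> \<ominus> q \<otimes> u) \<otimes> u = u \<otimes> (q \<oplus> \<one> \<ominus> q \<otimes> u)"
      using q(1) u by (simp add: minus_eq l_distr r_distr l_minus r_minus quu q(2)[symmetric])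
    ultimately show ?case using q(1) u by (intro bexI[of _ "q \<oplus> \<one> \<ominus> q \<otimes> u"]) auto
  qed
  then obtain q where q: "q \<in> carrier R" "q \<otimes> u = u \<otimes> q" "w [^] m = \<one> \<ominus> q \<otimes> u" by blast
  have um: "u [^] m \<in> carrier R" using u by simp
  have step: "u [^] m \<otimes> (q \<otimes> u) = u [^] m"
  proof -
    have "u [^] m \<ominus> u [^] m \<otimes> (q \<otimes> u) = \<zero>"
      using uw0 q um u by (simp add: minus_eq r_distr r_minus)
    then show ?thesis using um q u by simp
  qed
  have steps: "u [^] m \<otimes> (q \<otimes> u) [^] k = u [^] m" for k :: nat
  proof (induction k)
    case (Suc k)
    have "u [^] m \<otimes> (q \<otimes> u) [^] Suc k = (u [^] m \<otimes> (q \<otimes> u) [^] k) \<otimes> (q \<otimes> u)"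
      using q um u by (simp add: m_assoc)
    then show ?case using Suc step by simp
  qed (use um in simp)
  define e where "e = (q \<otimes> u) [^] m"
  have e_eq: "e = q [^] m \<otimes> u [^] m" unfolding e_def using pow_mult_distrib[of q u m] q u by simp
  have ee: "e \<otimes> e = e"
  proof -
    have ec: "e \<in> carrier R" using q(1) u by (simp add: e_def)
    have "e \<otimes> e = q [^] m \<otimes> (u [^] m \<otimes> e)"
      unfolding e_eq using q(1) u by (simp add: m_assoc)
    also have "u [^] m \<otimes> e = u [^] m" unfolding e_def by (rule steps)
    finally show ?thesis by (simp only: e_eq)
  qed
  define p where "p = (q \<otimes> u) [^] n \<otimes> q"
  have pc: "p \<in> carrier R" using q u by (simp add: p_def)
  have pu: "p \<otimes> u = e" using q u by (simp add: p_def e_def m_def m_assoc)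
  have quu: "u \<otimes> (q \<otimes> u) = (q \<otimes> u) \<otimes> u" using q(1,2) u m_assoc by metis
  have comm: "u \<otimes> (q \<otimes> u) [^] k = (q \<otimes> u) [^] k \<otimes> u" for k :: nat
  proof (induction k)
    case (Suc k)
    have "u \<otimes> (q \<otimes> u) [^] Suc k = (u \<otimes> (q \<otimes> u) [^] k) \<otimes> (q \<otimes> u)"
      using q(1) u by (simp add: m_assoc)
    also have "\<dots> = (q \<otimes> u) [^] k \<otimes> (u \<otimes> (q \<otimes> u))"
      unfolding Suc.IH using q(1) u by (simp add: m_assoc)
    also have "\<dots> = (q \<otimes> u) [^] Suc k \<otimes> u"
      unfolding quu using q(1) u by (simp add: m_assoc)
    finally show ?case .
  qed (use u in simp)
  have up: "u \<otimes> p = e"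
  proof -
    have "u \<otimes> p = (u \<otimes> (q \<otimes> u) [^] n) \<otimes> q" using q(1) u by (simp add: p_def m_assoc)
    also have "\<dots> = (q \<otimes> u) [^] n \<otimes> (u \<otimes> q)" unfolding comm using q(1) u by (simp add: m_assoc)
    also have "\<dots> = e" unfolding q(2)[symmetric] by (simp add: e_def m_def)
    finally show ?thesis .
  qed
  have "c \<otimes> e = c" if c: "c \<in> carrier R" "c \<otimes> u = c" for c
  proof -
    have cw: "c \<otimes> w = \<zero>" using c u by (simp add: w_def minus_eq r_distr r_minus r_neg)
    have "w [^] m = w \<otimes> w [^] n" using wc unfolding m_def by (metis nat_pow_Suc2)
    then have "c \<otimes> w [^] m = (c \<otimes> w) \<otimes> w [^] n" using c wc by (simp add: m_assoc)
    then have "c \<otimes> w [^] m = \<zero>" using cw wc by simp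
    then have "c \<ominus> c \<otimes> (q \<otimes> u) = \<zero>" using q c u by (simp add: minus_eq r_distr r_minus)
    then have cq: "c \<otimes> (q \<otimes> u) = c" using c q u by simp
    have "c \<otimes> (q \<otimes> u) [^] k = c" for k :: nat
    proof (induction k)
      case (Suc k)
      have "c \<otimes> (q \<otimes> u) [^] Suc k = (c \<otimes> (q \<otimes> u) [^] k) \<otimes> (q \<otimes> u)"
        using q c u by (simp add: m_assoc)
      then show ?case using Suc cq by simp
    qed (use c in simp)
    then show ?thesis by (simp add: e_def)
  qed
  then show ?thesis using that[of p] pc pu up ee by simp
qed

end

section \<open>Complements and idempotents\<close>

definition left_singular_nil :: "('a, 'r) ring_scheme \<Rightarrow> bool" where
  "left_singular_nil R \<longleftrightarrow> (\<forall>z\<in>left_singular R. \<exists>n::nat. z [^]\<^bsub>R\<^esub> n = \<zero>\<^bsub>R\<^esub>)"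

text \<open>
  Together with right noetherianness and nilpotence of the singular ideal this condition implies the
  descending chain condition on right ideals.
\<close>

definition nonsingular_idempotents :: "('a, 'r) ring_scheme \<Rightarrow> bool" where
  "nonsingular_idempotents R \<longleftrightarrow> (\<forall>x\<in>carrier R - left_singular R. \<exists>t\<in>carrier R.
     x \<otimes>\<^bsub>R\<^esub> t \<noteq> \<zero>\<^bsub>R\<^esub> \<and> (x \<otimes>\<^bsub>R\<^esub> t) \<otimes>\<^bsub>R\<^esub> (x \<otimes>\<^bsub>R\<^esub> t) = x \<otimes>\<^bsub>R\<^esub> t)"

context ring
begin

lemma left_ideal_sum_principalE:
  assumes "v \<in> T <+>\<^bsub>R\<^esub> PIdl y"
  obtains t r where "t \<in> T" "r \<in> carrier R" "v = t \<oplus> r \<otimes> y"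
  using assms by (auto simp: set_add_def' cgenideal_def)

lemma add_minus_cancel: "\<lbrakk>a \<in> carrier R; b \<in> carrier R\<rbrakk> \<Longrightarrow> (a \<oplus> b) \<ominus> a = b"
  by (simp add: minus_eq a_comm[of a b] a_assoc r_neg)

text \<open>
  If \<open>Ry\<close> met \<open>T + S\<close> only in \<open>0\<close>, then \<open>T + Ry\<close> would still meet \<open>S\<close> only in \<open>0\<close>, so \<open>y\<close> would lie in \<open>T\<close>
  by maximality.
\<close>

lemma complement_essential:
  assumes T: "left_ideal T R" and S: "left_ideal S R" and disj: "T \<inter> S = {\<zero>}"
    and max: "\<And>T'. \<lbrakk>left_ideal T' R; T' \<inter> S = {\<zero>}; T \<subseteq> T'\<rbrakk> \<Longrightarrow> T' = T"
    and y: "y \<in> carrier R" "y \<noteq> \<zero>"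
  shows "\<exists>r\<in>carrier R. r \<otimes> y \<noteq> \<zero> \<and> r \<otimes> y \<in> T <+>\<^bsub>R\<^esub> S"
proof (rule ccontr)
  assume none: "\<not> ?thesis"
  note TD = left_idealD[OF T] and SD = left_idealD[OF S]
  note P = left_ideal_principal[OF y(1)]
  note TS = left_idealD[OF left_ideal_sum(1)[OF T S]]
  let ?T = "T <+>\<^bsub>R\<^esub> PIdl y"
  have "v = \<zero>" if v: "v \<in> ?T" "v \<in> S" for v
  proof -
    obtain t r where tr: "t \<in> T" "r \<in> carrier R" "v = t \<oplus> r \<otimes> y" using left_ideal_sum_principalE[OF v(1)] .
    have "r \<otimes> y = v \<ominus> t" unfolding tr(3) using tr(1,2) TD(2) y by (simp add: add_minus_cancel)
    moreover have "v \<ominus> t \<in> T <+>\<^bsub>R\<^esub> S"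
      using TS(7) left_ideal_sum(2,3)[OF T S] v(2) tr(1) by blast
    ultimately have "r \<otimes> y = \<zero>" using none tr(2) by auto
    then have "v \<in> T" using tr TD(2) by simp
    then show ?thesis using v(2) disj by blast
  qed
  moreover have "\<zero> \<in> ?T" using left_idealD(3)[OF left_ideal_sum(1)[OF T P]] .
  ultimately have "?T \<inter> S = {\<zero>}" using SD(3) by blast
  then have "?T = T" using max[OF left_ideal_sum(1)[OF T P] _ left_ideal_sum(2)[OF T P]] by simp
  then have "y \<in> T" using left_ideal_sum(3)[OF T P] principal_self[OF y(1)] by blast
  then have "\<one> \<otimes> y \<in> T <+>\<^bsub>R\<^esub> S" using left_ideal_sum(2)[OF T S] y(1) by auto
  moreover have "\<one> \<otimes> y \<noteq> \<zero>" using y by simp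
  ultimately show False using none one_closed by blast
qed

text \<open>
  The element \<open>w\<close> acts as the projection of \<open>T + S\<close> to \<open>T\<close>, so \<open>w - w^2\<close> is annihilated by the essential left
  ideal \<open>T + S\<close> and is therefore singular.
\<close>

lemma complement_projection_idempotent:
  assumes nil: "left_singular_nil R"
    and T: "left_ideal T R" and S: "left_ideal S R" and disj: "T \<inter> S = {\<zero>}"
    and max: "\<And>T'. \<lbrakk>left_ideal T' R; T' \<inter> S = {\<zero>}; T \<subseteq> T'\<rbrakk> \<Longrightarrow> T' = T"
    and w: "w \<in> carrier R" "\<And>t. t \<in> T \<Longrightarrow> t \<otimes> w = t" "\<And>s. s \<in> S \<Longrightarrow> s \<otimes> w = \<zero>"
  shows "\<exists>q\<in>carrier R. (w \<otimes> q) \<otimes> (w \<otimes> q) = w \<otimes> q \<and> (\<forall>t\<in>T. t \<otimes> (w \<otimes> q) = t)"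
proof -
  note TD = left_idealD[OF T] and SD = left_idealD[OF S]
  have "w \<ominus> w \<otimes> w \<in> left_singular R"
  proof (rule left_singularI)
    show "w \<ominus> w \<otimes> w \<in> carrier R" using w(1) by simp
    fix y assume y: "y \<in> carrier R" "y \<noteq> \<zero>"
    then obtain r where r: "r \<in> carrier R" "r \<otimes> y \<noteq> \<zero>" "r \<otimes> y \<in> T <+>\<^bsub>R\<^esub> S"
      using complement_essential[OF T S disj max] by blast
    then obtain t s where ts: "t \<in> T" "s \<in> S" "r \<otimes> y = t \<oplus> s" by (auto simp: set_add_def')
    note c = TD(2)[OF ts(1)] SD(2)[OF ts(2)]
    have "(t \<oplus> s) \<otimes> w = t" using c w ts by (simp add: l_distr)
    moreover have "(t \<oplus> s) \<otimes> (w \<ominus> w \<otimes> w) = (t \<oplus> s) \<otimes> w \<ominus> ((t \<oplus> s) \<otimes> w) \<otimes> w"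
      using c w(1) by (simp add: minus_eq r_distr r_minus m_assoc)
    ultimately have "r \<otimes> y \<otimes> (w \<ominus> w \<otimes> w) = \<zero>" using ts w c by simp
    then show "\<exists>r\<in>carrier R. r \<otimes> y \<noteq> \<zero> \<and> r \<otimes> y \<otimes> (w \<ominus> w \<otimes> w) = \<zero>" using r by blast
  qed
  then obtain n :: nat where "(w \<ominus> w \<otimes> w) [^] n = \<zero>" using nil unfolding left_singular_nil_def by blast
  then obtain q where q: "q \<in> carrier R" "q \<otimes> w = w \<otimes> q" "(q \<otimes> w) \<otimes> (q \<otimes> w) = q \<otimes> w"
    "\<And>c. \<lbrakk>c \<in> carrier R; c \<otimes> w = c\<rbrakk> \<Longrightarrow> c \<otimes> (q \<otimes> w) = c"
    using nilpotent_imp_idempotent[OF w(1)] by metis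
  show ?thesis
  proof (intro bexI conjI ballI)
    show "(w \<otimes> q) \<otimes> (w \<otimes> q) = w \<otimes> q" using q(2,3) by simp
    show "t \<otimes> (w \<otimes> q) = t" if "t \<in> T" for t using q(4)[of t] w(2) TD(2) that q(2) by simp
  qed (rule q(1))
qed

text \<open>
  Let \<open>C\<close> be a complement of \<open>S\<close>. The projection of \<open>C + S\<close> to \<open>C\<close> is a right multiplication, and its
  correction to an idempotent \<open>e\<close> still fixes \<open>C\<close> and annihilates \<open>S\<close>. Maximality gives \<open>C = Re\<close>, and
  \<open>R(1 - e) + Re = R\<close> shows that \<open>Re\<close> can be small only if \<open>e = 0\<close>.
\<close>

lemma left_baer_imp_complement_not_small:
  assumes baer: "left_baer R" and nil: "left_singular_nil R"
    and C: "complement_left_ideal C R" "C \<noteq> {\<zero>}"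
  shows "\<not> small_left_ideal C R"
proof
  assume small: "small_left_ideal C R"
  obtain S where CS: "left_ideal C R" "left_ideal S R" "C \<inter> S = {\<zero>}"
    and max: "\<And>T'. \<lbrakk>left_ideal T' R; T' \<inter> S = {\<zero>}; C \<subseteq> T'\<rbrakk> \<Longrightarrow> T' = C"
    using C(1) unfolding complement_left_ideal_def by auto
  note CD = left_idealD[OF CS(1)] and SD = left_idealD[OF CS(2)]
  obtain f where f: "f \<in> ideal_homs R (C <+>\<^bsub>R\<^esub> S)" "\<forall>c\<in>C. f c = c" "\<forall>s\<in>S. f s = \<zero>"
    using left_ideal_projection[OF CS] by auto
  obtain w where w: "w \<in> carrier R" "\<And>x. x \<in> C <+>\<^bsub>R\<^esub> S \<Longrightarrow> f x = x \<otimes> w"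
    using baer[unfolded left_baer_def, rule_format, OF conjI[OF left_ideal_sum(1)[OF CS(1,2)] f(1)]] by auto
  have wC: "c \<otimes> w = c" if "c \<in> C" for c
    using that f(2) w(2) left_ideal_sum(2)[OF CS(1,2)] by force
  have wS: "s \<otimes> w = \<zero>" if "s \<in> S" for s
    using that f(3) w(2) left_ideal_sum(3)[OF CS(1,2)] by force
  obtain q where q: "q \<in> carrier R" "(w \<otimes> q) \<otimes> (w \<otimes> q) = w \<otimes> q" "\<And>c. c \<in> C \<Longrightarrow> c \<otimes> (w \<otimes> q) = c"
    using complement_projection_idempotent[OF nil CS max w(1) wC wS] by auto
  define e where "e = w \<otimes> q"
  have e: "e \<in> carrier R" "e \<otimes> e = e" "\<And>c. c \<in> C \<Longrightarrow> c \<otimes> e = c" using q w(1) by (simp_all add: e_def)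
  have eS: "s \<otimes> e = \<zero>" if "s \<in> S" for s
    using wS[OF that] SD(2)[OF that] w(1) q(1) by (simp add: e_def m_assoc[symmetric])
  have "PIdl e = C"
  proof (rule max)
    show "left_ideal (PIdl e) R" using left_ideal_principal[OF e(1)] .
    have "s = \<zero>" if s: "s \<in> PIdl e" "s \<in> S" for s
    proof -
      obtain r where "r \<in> carrier R" "s = r \<otimes> e" using s by (auto simp: cgenideal_def)
      then have "s = s \<otimes> e" using e by (simp add: m_assoc)
      then show ?thesis using eS s by simp
    qed
    then show "PIdl e \<inter> S = {\<zero>}"
      using SD(3) left_idealD(3)[OF left_ideal_principal[OF e(1)]] by blast
    show "C \<subseteq> PIdl e"
    proof
      fix c assume "c \<in> C"
      then have "c = c \<otimes> e" "c \<in> carrier R" using e(3) CD(2) by auto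
      then show "c \<in> PIdl e" unfolding cgenideal_def by blast
    qed
  qed
  then have eC: "e \<in> C" using principal_self[OF e(1)] by simp
  let ?K = "PIdl (\<one> \<ominus> e)"
  have oc: "\<one> \<ominus> e \<in> carrier R" using e by simp
  note K = left_ideal_principal[OF oc]
  have "\<one> \<in> ?K <+>\<^bsub>R\<^esub> C"
  proof -
    have "\<one> = (\<one> \<ominus> e) \<oplus> e" using e by (simp add: minus_eq a_assoc l_neg)
    then show ?thesis using principal_self[OF oc] eC by (auto simp: set_add_def')
  qed
  then have "x \<in> ?K <+>\<^bsub>R\<^esub> C" if "x \<in> carrier R" for x
    using left_idealD(5)[OF left_ideal_sum(1)[OF K CS(1)] that, of \<one>] that by simp
  then have "?K <+>\<^bsub>R\<^esub> C = carrier R" using left_idealD(1)[OF left_ideal_sum(1)[OF K CS(1)]] by blast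
  then have "?K = carrier R" using small K unfolding small_left_ideal_def by blast
  then have "\<one> \<in> ?K" by simp
  then obtain r where r: "r \<in> carrier R" "\<one> = r \<otimes> (\<one> \<ominus> e)" by (auto simp: cgenideal_def)
  have "(\<one> \<ominus> e) \<otimes> e = \<zero>" using e(1,2) by (simp add: minus_eq l_distr l_minus r_neg)
  moreover have "e = r \<otimes> ((\<one> \<ominus> e) \<otimes> e)" using r e(1) oc by (metis m_assoc l_one)
  ultimately have "e = \<zero>" using r by simp
  then have "C \<subseteq> {\<zero>}" using e(3) CD(2) by force
  then show False using C(2) CD(3) by blast
qed

text \<open>
  Right multiplication by \<open>x\<close> is injective on some \<open>Ry \<noteq> 0\<close>. Enlarge \<open>Ry\<close> to a \<open>T\<close> that is maximal with
  \<open>T \<inter> l x = 0\<close>. The inverse of the map from \<open>T\<close> to \<open>Tx\<close> is the right multiplication by some \<open>s\<close>, so \<open>xs\<close> acts as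
  the projection of \<open>T + l x\<close> to \<open>T\<close>.
\<close>

lemma left_baer_imp_nonsingular_idempotents:
  assumes baer: "left_baer R" and nil: "left_singular_nil R"
  shows "nonsingular_idempotents R"
  unfolding nonsingular_idempotents_def
proof
  fix x assume "x \<in> carrier R - left_singular R"
  then have x: "x \<in> carrier R" "x \<notin> left_singular R" by auto
  obtain y where y: "y \<in> carrier R" "y \<noteq> \<zero>" "\<And>r. \<lbrakk>r \<in> carrier R; r \<otimes> y \<otimes> x = \<zero>\<rbrakk> \<Longrightarrow> r \<otimes> y = \<zero>"
    using not_left_singular[OF x] by auto
  let ?S = "left_ann R {x}"
  have S: "left_ideal ?S R" by (rule left_ideal_left_ann) (use x in simp)
  have "v = \<zero>" if "v \<in> PIdl y" "v \<in> ?S" for v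
    using that y(3) by (auto simp: cgenideal_def left_ann_def)
  then have disj: "PIdl y \<inter> ?S = {\<zero>}"
    using left_idealD(3)[OF left_ideal_principal[OF y(1)]] left_idealD(3)[OF S] by blast
  obtain T where T: "left_ideal T R" "PIdl y \<subseteq> T" "T \<inter> ?S = {\<zero>}"
    and max: "\<And>T'. \<lbrakk>left_ideal T' R; T' \<inter> ?S = {\<zero>}; T \<subseteq> T'\<rbrakk> \<Longrightarrow> T' = T"
    using left_ideal_maximal_disjoint[OF left_ideal_principal[OF y(1)] disj] by auto
  have yT: "y \<in> T" using T(2) principal_self[OF y(1)] by blast
  note TD = left_idealD[OF T(1)]
  have one_hom: "(\<lambda>t. t) \<in> ideal_homs R T" using TD(2) by (auto simp: ideal_homs_iff)
  have "t = \<zero>" if "t \<in> T" "t \<otimes> x = \<zero>" for t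
    using that T(3) TD(2) by (auto simp: left_ann_def)
  then have "\<exists>s\<in>carrier R. \<forall>t\<in>T. t = t \<otimes> x \<otimes> s"
    by (rule left_baer_factor[OF baer T(1) right_mult_ideal_hom[OF T(1) x(1)] one_hom])
  then obtain s where s: "s \<in> carrier R" "\<forall>t\<in>T. t = t \<otimes> x \<otimes> s" by (elim bexE)
  have xs1: "t \<otimes> (x \<otimes> s) = t" if "t \<in> T" for t
    using bspec[OF s(2) that] TD(2)[OF that] x(1) s(1) by (simp add: m_assoc)
  have xs0: "v \<otimes> (x \<otimes> s) = \<zero>" if "v \<in> ?S" for v
  proof -
    have v: "v \<in> carrier R" "v \<otimes> x = \<zero>" using that by (simp_all add: left_ann_def)
    have "v \<otimes> (x \<otimes> s) = (v \<otimes> x) \<otimes> s" using v(1) x(1) s(1) by (simp add: m_assoc)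
    then show ?thesis using v s(1) by simp
  qed
  obtain q where q: "q \<in> carrier R" "((x \<otimes> s) \<otimes> q) \<otimes> ((x \<otimes> s) \<otimes> q) = (x \<otimes> s) \<otimes> q"
    "\<And>t. t \<in> T \<Longrightarrow> t \<otimes> ((x \<otimes> s) \<otimes> q) = t"
    using complement_projection_idempotent[OF nil T(1) S T(3) max m_closed[OF x(1) s(1)] xs1 xs0] by auto
  have eq: "(x \<otimes> s) \<otimes> q = x \<otimes> (s \<otimes> q)" using x(1) s(1) q(1) by (simp add: m_assoc)
  show "\<exists>t\<in>carrier R. x \<otimes> t \<noteq> \<zero> \<and> (x \<otimes> t) \<otimes> (x \<otimes> t) = x \<otimes> t"
  proof (intro bexI conjI)
    show "x \<otimes> (s \<otimes> q) \<otimes> (x \<otimes> (s \<otimes> q)) = x \<otimes> (s \<otimes> q)" using q(2) unfolding eq .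
    have "y \<otimes> (x \<otimes> (s \<otimes> q)) = y" using q(3)[OF yT] unfolding eq .
    then show "x \<otimes> (s \<otimes> q) \<noteq> \<zero>" using y(1,2) by auto
    show "s \<otimes> q \<in> carrier R" using s q by simp
  qed
qed

lemma opposite_nat_pow: "x \<in> carrier R \<Longrightarrow> x [^]\<^bsub>opposite R\<^esub> (n::nat) = x [^] n"
proof (induction n)
  case 0
  show ?case using ring.ring_simprules(6)[OF opposite_ring] by (simp add: nat_pow_def)
next
  case (Suc n)
  interpret op: ring "opposite R" by (rule opposite_ring)
  have "x [^]\<^bsub>opposite R\<^esub> Suc n = x \<otimes> x [^] n" using Suc by (simp add: op.nat_pow_Suc)
  then show ?case using Suc.prems by (metis nat_pow_Suc2)
qed

text \<open>
  If a right singular \<open>x\<close> were not left singular, there would be \<open>y \<noteq> 0\<close> with \<open>y = yxs\<close>. But \<open>xs\<close> is right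
  singular, so \<open>1 - xs\<close> is a unit, which forces \<open>y = 0\<close>.
\<close>

lemma right_baer_imp_right_singular_subset:
  assumes baer: "left_baer (opposite R)" and inj: "left_p_injective R"
  shows "left_singular (opposite R) \<subseteq> left_singular R"
proof
  fix x assume xr: "x \<in> left_singular (opposite R)"
  have x: "x \<in> carrier R" using ring.left_singular_closed[OF opposite_ring xr] by simp
  show "x \<in> left_singular R"
  proof (rule ccontr)
    assume "x \<notin> left_singular R"
    then obtain y where y: "y \<in> carrier R" "y \<noteq> \<zero>" "\<And>r. \<lbrakk>r \<in> carrier R; r \<otimes> y \<otimes> x = \<zero>\<rbrakk> \<Longrightarrow> r \<otimes> y = \<zero>"
      using not_left_singular[OF x] by auto
    obtain s where s: "s \<in> carrier R" "y = y \<otimes> x \<otimes> s" using left_p_injective_cancel[OF inj y(1) x y(3)] by auto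
    have "x \<otimes> s \<in> left_singular (opposite R)" using right_idealD(5)[OF right_singular_right_ideal s(1) xr] .
    moreover have "left_p_injective (opposite R)"
      using ring.left_baer_imp_p_injective[OF opposite_ring baer] .
    ultimately obtain t where t: "t \<in> carrier R" "(\<one> \<ominus> x \<otimes> s) \<otimes> t = \<one>"
      using ring.one_minus_singular_unit[OF opposite_ring, of "x \<otimes> s"] by auto
    have "y \<otimes> (\<one> \<ominus> x \<otimes> s) = y \<ominus> y \<otimes> x \<otimes> s" using y(1) x s(1) by (simp add: minus_eq r_distr r_minus m_assoc)
    then have "y \<otimes> (\<one> \<ominus> x \<otimes> s) = \<zero>" using y(1) s(2) by simp
    moreover have "y = y \<otimes> (\<one> \<ominus> x \<otimes> s) \<otimes> t" using y(1) x s(1) t by (simp add: m_assoc)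
    ultimately show False using y(2) t(1) by simp
  qed
qed

text \<open>
  In the opposite ring one obtains a nonzero idempotent \<open>tx\<close> in \<open>Rx\<close>. Then \<open>xtxt\<close> is a nonzero idempotent
  in \<open>xR\<close>.
\<close>

lemma right_baer_imp_nonsingular_idempotents:
  assumes baer: "left_baer (opposite R)" and inj: "left_p_injective R" and nil: "left_singular_nil R"
  shows "nonsingular_idempotents R"
proof -
  note sub = right_baer_imp_right_singular_subset[OF baer inj]
  have "left_singular_nil (opposite R)"
    unfolding left_singular_nil_def
  proof
    fix z assume "z \<in> left_singular (opposite R)"
    then have z: "z \<in> left_singular R" using sub by blast
    then obtain n :: nat where "z [^] n = \<zero>" using nil unfolding left_singular_nil_def by blast
    then show "\<exists>n::nat. z [^]\<^bsub>opposite R\<^esub> n = \<zero>\<^bsub>opposite R\<^esub>"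
      using left_singular_closed[OF z] by (auto simp: opposite_nat_pow)
  qed
  then have op: "nonsingular_idempotents (opposite R)"
    using ring.left_baer_imp_nonsingular_idempotents[OF opposite_ring baer] by simp
  show ?thesis
    unfolding nonsingular_idempotents_def
  proof
    fix x assume "x \<in> carrier R - left_singular R"
    then have x: "x \<in> carrier R" and "x \<in> carrier (opposite R) - left_singular (opposite R)" using sub by auto
    then obtain t where t: "t \<in> carrier R" "t \<otimes> x \<noteq> \<zero>" "(t \<otimes> x) \<otimes> (t \<otimes> x) = t \<otimes> x"
      using op unfolding nonsingular_idempotents_def by auto
    define g where "g = x \<otimes> (t \<otimes> x \<otimes> t)"
    have "g \<otimes> g = x \<otimes> (((t \<otimes> x) \<otimes> (t \<otimes> x)) \<otimes> (t \<otimes> x) \<otimes> t)" using x t(1) by (simp add: g_def m_assoc)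
    then have gg: "g \<otimes> g = g" unfolding t(3) using t by (simp add: g_def)
    have "t \<otimes> g \<otimes> x = ((t \<otimes> x) \<otimes> (t \<otimes> x)) \<otimes> (t \<otimes> x)" using x t(1) by (simp add: g_def m_assoc)
    then have "t \<otimes> g \<otimes> x = t \<otimes> x" using t(3) by simp
    then have "g \<noteq> \<zero>" using t x by auto
    then show "\<exists>t\<in>carrier R. x \<otimes> t \<noteq> \<zero> \<and> (x \<otimes> t) \<otimes> (x \<otimes> t) = x \<otimes> t"
      using gg x t(1) unfolding g_def by (intro bexI[of _ "t \<otimes> x \<otimes> t"]) auto
  qed
qed

end

section \<open>Idempotents from complements that are not small\<close>

context ring
begin

text \<open>
  The idempotent is found inside a complement \<open>C\<close> that is a maximal essential extension of a uniform
  left ideal \<open>Rd\<close>. Uniformity of \<open>C\<close> turns an element of \<open>C\<close> outside the singular ideal into one that is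
  idempotent modulo the singular ideal.
\<close>

lemma not_small_complements_imp_nonsingular_idempotents:
  assumes f_inj: "left_f_injective R" and p_inj: "left_p_injective R"
    and nil: "left_singular_nil R" and noeth: "right_noetherian R"
    and ncs: "\<And>C. \<lbrakk>complement_left_ideal C R; C \<noteq> {\<zero>}\<rbrakk> \<Longrightarrow> \<not> small_left_ideal C R"
  shows "nonsingular_idempotents R"
  unfolding nonsingular_idempotents_def
proof
  fix x assume "x \<in> carrier R - left_singular R"
  then have x: "x \<in> carrier R" "x \<notin> left_singular R" by auto
  obtain y where y: "y \<in> carrier R" "y \<noteq> \<zero>" "\<And>r. \<lbrakk>r \<in> carrier R; r \<otimes> y \<otimes> x = \<zero>\<rbrakk> \<Longrightarrow> r \<otimes> y = \<zero>"
    using not_left_singular[OF x] by auto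
  \<comment> \<open>If \<open>r d\<close> is maximal here, all nonzero multiples of \<open>d\<close> have the same right annihilator, so that any
    two of them have a nonzero common multiple.\<close>
  define F where "F = (\<lambda>d. right_ann R {d}) ` {d \<in> PIdl y. d \<noteq> \<zero>}"
  note Ry = left_idealD[OF left_ideal_principal[OF y(1)]]
  have F_ideals: "right_ideal I R" if "I \<in> F" for I
    using that Ry(2) right_ideal_right_ann by (auto simp: F_def)
  have F_ne: "F \<noteq> {}" using principal_self[OF y(1)] y(2) by (auto simp: F_def)
  have "\<exists>M\<in>F. \<forall>I\<in>F. M \<subseteq> I \<longrightarrow> I = M"
    by (rule right_noetherian_maximal[OF noeth F_ne F_ideals])
  then obtain M where M: "M \<in> F" "\<forall>I\<in>F. M \<subseteq> I \<longrightarrow> I = M" by (elim bexE)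
  then obtain d where d: "d \<in> PIdl y" "d \<noteq> \<zero>" "M = right_ann R {d}" by (auto simp: F_def)
  have dc: "d \<in> carrier R" using Ry(2) d(1) .
  let ?D = "PIdl d"
  note D = left_ideal_principal[OF dc]
  note DD = left_idealD[OF D]
  have dD: "d \<in> ?D" using principal_self[OF dc] .
  have Dy: "?D \<subseteq> PIdl y" using Ry(5)[OF _ d(1)] by (auto simp: cgenideal_def)
  have ann_d: "right_ann R {v} = right_ann R {d}" if v: "v \<in> ?D" "v \<noteq> \<zero>" for v
  proof -
    obtain p where p: "p \<in> carrier R" "v = p \<otimes> d" using v(1) by (auto simp: cgenideal_def)
    have "right_ann R {d} \<subseteq> right_ann R {v}"
      using p dc by (auto simp: left_ann_def m_assoc)
    moreover have "right_ann R {v} \<in> F" using v Dy by (auto simp: F_def)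
    ultimately show ?thesis using M(2) d(3) by auto
  qed
  have D_uniform: "\<exists>r\<in>carrier R. \<exists>s\<in>carrier R. r \<otimes> u = s \<otimes> v \<and> r \<otimes> u \<noteq> \<zero>"
    if "u \<in> ?D" "u \<noteq> \<zero>" "v \<in> ?D" "v \<noteq> \<zero>" for u v
    using f_injective_common_multiple[OF f_inj, of u v] ann_d[of u] ann_d[of v] that DD(2) by auto
  \<comment> \<open>A complement \<open>C\<close> of a complement \<open>S\<close> of \<open>Rd\<close>, taken to contain \<open>Rd\<close>, is an essential extension of
    \<open>Rd\<close>.\<close>
  have zero_D: "{\<zero>} \<inter> ?D = {\<zero>}" using DD(3) by auto
  obtain S where S: "left_ideal S R" "S \<inter> ?D = {\<zero>}"
    and S_max: "\<And>S'. \<lbrakk>left_ideal S' R; S' \<inter> ?D = {\<zero>}; S \<subseteq> S'\<rbrakk> \<Longrightarrow> S' = S"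
    using left_ideal_maximal_disjoint[OF left_ideal_zero zero_D] by auto
  have D_S: "?D \<inter> S = {\<zero>}" using S(2) by auto
  obtain C where C: "left_ideal C R" "?D \<subseteq> C" "C \<inter> S = {\<zero>}"
    and C_max: "\<forall>C'. left_ideal C' R \<and> C' \<inter> S = {\<zero>} \<and> C \<subseteq> C' \<longrightarrow> C' = C"
    using left_ideal_maximal_disjoint[OF D D_S] by (elim exE conjE)
  note SD = left_idealD[OF S(1)] and CD = left_idealD[OF C(1)]
  have C_ess: "\<exists>r\<in>carrier R. r \<otimes> c \<noteq> \<zero> \<and> r \<otimes> c \<in> ?D" if c: "c \<in> C" "c \<noteq> \<zero>" for c
  proof (rule ccontr)
    assume none: "\<not> ?thesis"
    have cc: "c \<in> carrier R" using CD(2) c(1) .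
    note P = left_ideal_principal[OF cc]
    have "v = \<zero>" if v: "v \<in> S <+>\<^bsub>R\<^esub> PIdl c" "v \<in> ?D" for v
    proof -
      obtain s r where sr: "s \<in> S" "r \<in> carrier R" "v = s \<oplus> r \<otimes> c" using left_ideal_sum_principalE[OF v(1)] .
      have rc: "r \<otimes> c \<in> C" using CD(5)[OF sr(2) c(1)] .
      have "s = v \<ominus> r \<otimes> c" using sr SD(2) cc by (simp add: minus_eq a_assoc r_neg)
      then have "s \<in> C" using CD(7)[OF _ rc, of v] v(2) C(2) by auto
      then have "s = \<zero>" using sr(1) C(3) by blast
      then have "v = r \<otimes> c" using sr(2,3) cc by simp
      then show ?thesis using none v(2) sr(2) by auto
    qed
    moreover have "\<zero> \<in> S <+>\<^bsub>R\<^esub> PIdl c" using left_idealD(3)[OF left_ideal_sum(1)[OF S(1) P]] .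
    ultimately have "(S <+>\<^bsub>R\<^esub> PIdl c) \<inter> ?D = {\<zero>}" using DD(3) by blast
    then have "S <+>\<^bsub>R\<^esub> PIdl c = S"
      using S_max[OF left_ideal_sum(1)[OF S(1) P] _ left_ideal_sum(2)[OF S(1) P]] by simp
    then have "c \<in> S" using left_ideal_sum(3)[OF S(1) P] principal_self[OF cc] by blast
    then show False using c C(3) by blast
  qed
  have C_uniform: "\<exists>r\<in>carrier R. \<exists>s\<in>carrier R. r \<otimes> u = s \<otimes> v \<and> r \<otimes> u \<noteq> \<zero>"
    if uv: "u \<in> C" "u \<noteq> \<zero>" "v \<in> C" "v \<noteq> \<zero>" for u v
  proof -
    obtain p where p: "p \<in> carrier R" "p \<otimes> u \<noteq> \<zero>" "p \<otimes> u \<in> ?D" using C_ess uv by blast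
    obtain q where q: "q \<in> carrier R" "q \<otimes> v \<noteq> \<zero>" "q \<otimes> v \<in> ?D" using C_ess uv by blast
    obtain r s where "r \<in> carrier R" "s \<in> carrier R" "r \<otimes> (p \<otimes> u) = s \<otimes> (q \<otimes> v)" "r \<otimes> (p \<otimes> u) \<noteq> \<zero>"
      using D_uniform[OF p(3,2) q(3,2)] by blast
    then show ?thesis
      using p(1) q(1) uv(1,3) CD(2) by (intro bexI[of _ "r \<otimes> p"] bexI[of _ "s \<otimes> q"]) (simp_all add: m_assoc)
  qed
  \<comment> \<open>A left ideal of singular elements is small, since \<open>1 - c\<close> is a unit for each of its elements \<open>c\<close>.\<close>
  have "\<exists>c. c \<in> C \<and> c \<notin> left_singular R"
  proof (rule ccontr)
    assume "\<not> ?thesis"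
    then have CZ: "C \<subseteq> left_singular R" by blast
    have "complement_left_ideal C R"
      unfolding complement_left_ideal_def using C(1,3) S(1) C_max by blast
    moreover have "C \<noteq> {\<zero>}" using C(2) dD d(2) by blast
    moreover have "small_left_ideal C R"
      unfolding small_left_ideal_def
    proof (intro conjI allI impI C(1), elim conjE)
      fix K assume K: "left_ideal K R" "K <+>\<^bsub>R\<^esub> C = carrier R"
      note KD = left_idealD[OF K(1)]
      have "\<one> \<in> K <+>\<^bsub>R\<^esub> C" using K(2) by simp
      then obtain k c where kc: "k \<in> K" "c \<in> C" "\<one> = k \<oplus> c" by (auto simp: set_add_def')
      obtain t where t: "t \<in> carrier R" "t \<otimes> (\<one> \<ominus> c) = \<one>"
        using one_minus_singular_unit[OF p_inj subsetD[OF CZ kc(2)]] .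
      have "\<one> \<ominus> c = k" unfolding kc(3) using KD(2)[OF kc(1)] CD(2)[OF kc(2)] by (simp add: minus_eq a_assoc r_neg)
      then have "\<one> \<in> K" using t KD(5)[OF t(1) kc(1)] by simp
      then have "r \<in> K" if "r \<in> carrier R" for r using KD(5)[OF that, of \<one>] that by simp
      then show "K = carrier R" using KD(1) by blast
    qed
    ultimately show False using ncs by blast
  qed
  then obtain c where c: "c \<in> C" "c \<notin> left_singular R" by blast
  have cc: "c \<in> carrier R" using CD(2) c(1) .
  obtain v where v: "v \<in> carrier R" "v \<noteq> \<zero>" "\<And>r. \<lbrakk>r \<in> carrier R; r \<otimes> v \<otimes> c = \<zero>\<rbrakk> \<Longrightarrow> r \<otimes> v = \<zero>"
    using not_left_singular[OF cc c(2)] by auto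
  obtain s where s: "s \<in> carrier R" "v \<otimes> c \<otimes> s = v"
    using left_p_injective_cancel[OF p_inj v(1) cc v(3)] by auto
  \<comment> \<open>From \<open>v = vcs\<close> one gets \<open>au = a\<close> for \<open>a = vc\<close> and \<open>u = sc\<close>, both in \<open>C\<close>. As \<open>C\<close> is uniform, every nonzero
    \<open>zu\<close> has a nonzero multiple in \<open>Ra\<close>, where \<open>u\<close> acts as the identity.\<close>
  define a where "a = v \<otimes> c"
  define u where "u = s \<otimes> c"
  have aC: "a \<in> C" and uC: "u \<in> C" using CD(5) v(1) s(1) c(1) by (simp_all add: a_def u_def)
  note ac = CD(2)[OF aC] and uc = CD(2)[OF uC]
  have a0: "a \<noteq> \<zero>"
  proof
    assume "a = \<zero>"
    then have "\<one> \<otimes> v = \<zero>" using v(1) cc by (intro v(3)) (simp_all add: a_def)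
    then show False using v by simp
  qed
  have au: "a \<otimes> u = a"
  proof -
    have "a \<otimes> u = (v \<otimes> c \<otimes> s) \<otimes> c" using v(1) cc s(1) by (simp add: a_def u_def m_assoc)
    then show ?thesis using s(2) by (simp add: a_def)
  qed
  have "u \<ominus> u \<otimes> u \<in> left_singular R"
  proof (rule left_singularI)
    show "u \<ominus> u \<otimes> u \<in> carrier R" using uc by simp
    fix z assume z: "z \<in> carrier R" "z \<noteq> \<zero>"
    have eq: "r \<otimes> z \<otimes> (u \<ominus> u \<otimes> u) = r \<otimes> (z \<otimes> u) \<ominus> r \<otimes> (z \<otimes> u) \<otimes> u" if "r \<in> carrier R" for r
      using that z(1) uc by (simp add: minus_eq r_distr r_minus m_assoc)
    show "\<exists>r\<in>carrier R. r \<otimes> z \<noteq> \<zero> \<and> r \<otimes> z \<otimes> (u \<ominus> u \<otimes> u) = \<zero>"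
    proof (cases "z \<otimes> u = \<zero>")
      case True
      then show ?thesis using eq[of \<one>] z uc by (intro bexI[of _ \<one>]) auto
    next
      case False
      have "z \<otimes> u \<in> C" using CD(5) z(1) uC .
      then obtain r q where rq: "r \<in> carrier R" "q \<in> carrier R" "r \<otimes> (z \<otimes> u) = q \<otimes> a" "r \<otimes> (z \<otimes> u) \<noteq> \<zero>"
        using C_uniform[OF _ False aC a0] by blast
      have "r \<otimes> (z \<otimes> u) \<otimes> u = r \<otimes> (z \<otimes> u)" unfolding rq(3) using rq(2) ac uc au by (simp add: m_assoc)
      then have "r \<otimes> z \<otimes> (u \<ominus> u \<otimes> u) = \<zero>" using eq[OF rq(1)] rq(1) z(1) uc by simp
      moreover have "r \<otimes> z \<noteq> \<zero>" using rq(1,4) z(1) uc by (auto simp: m_assoc[symmetric])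
      ultimately show ?thesis using rq(1) by blast
    qed
  qed
  then obtain n :: nat where "(u \<ominus> u \<otimes> u) [^] n = \<zero>" using nil unfolding left_singular_nil_def by blast
  then obtain q where q: "q \<in> carrier R" "(q \<otimes> u) \<otimes> (q \<otimes> u) = q \<otimes> u"
    "\<And>c. \<lbrakk>c \<in> carrier R; c \<otimes> u = c\<rbrakk> \<Longrightarrow> c \<otimes> (q \<otimes> u) = c"
    using nilpotent_imp_idempotent[OF uc] by metis
  define f where "f = q \<otimes> u"
  have fC: "f \<in> C" using CD(5)[OF q(1) uC] by (simp add: f_def)
  note fc = CD(2)[OF fC]
  have ff: "f \<otimes> f = f" using q(2) by (simp add: f_def)
  have f0: "f \<noteq> \<zero>" using q(3)[OF ac au] a0 ac by (auto simp: f_def[symmetric])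
  have "r \<otimes> f = \<zero>" if r: "r \<in> carrier R" "r \<otimes> f \<otimes> x = \<zero>" for r
  proof (rule ccontr)
    assume "r \<otimes> f \<noteq> \<zero>"
    then obtain p where p: "p \<in> carrier R" "p \<otimes> (r \<otimes> f) \<noteq> \<zero>" "p \<otimes> (r \<otimes> f) \<in> ?D"
      using C_ess CD(5)[OF r(1) fC] by blast
    then obtain r' where r': "r' \<in> carrier R" "p \<otimes> (r \<otimes> f) = r' \<otimes> y" using Dy by (auto simp: cgenideal_def)
    have "p \<otimes> (r \<otimes> f) \<otimes> x = p \<otimes> (r \<otimes> f \<otimes> x)" using p(1) r(1) fc x(1) by (simp add: m_assoc)
    then have "r' \<otimes> y \<otimes> x = \<zero>" using r r' p(1) by simp
    then show False using y(3)[OF r'(1)] r'(2) p(2) by simp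
  qed
  then obtain t where t: "t \<in> carrier R" "f \<otimes> x \<otimes> t = f"
    using left_p_injective_cancel[OF p_inj fc x(1)] by auto
  have "x \<otimes> (t \<otimes> f) \<otimes> (x \<otimes> (t \<otimes> f)) = x \<otimes> t \<otimes> (f \<otimes> x \<otimes> t) \<otimes> f"
    using x(1) t(1) fc by (simp add: m_assoc)
  also have "\<dots> = x \<otimes> (t \<otimes> f)" unfolding t(2) using x(1) t(1) fc ff by (simp add: m_assoc)
  finally have "x \<otimes> (t \<otimes> f) \<otimes> (x \<otimes> (t \<otimes> f)) = x \<otimes> (t \<otimes> f)" .
  moreover have "f \<otimes> (x \<otimes> (t \<otimes> f)) = f"
  proof -
    have "f \<otimes> (x \<otimes> (t \<otimes> f)) = (f \<otimes> x \<otimes> t) \<otimes> f" using x(1) t(1) fc by (simp add: m_assoc)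
    then show ?thesis using t(2) ff by simp
  qed
  then have "x \<otimes> (t \<otimes> f) \<noteq> \<zero>" using f0 fc by auto
  ultimately show "\<exists>t\<in>carrier R. x \<otimes> t \<noteq> \<zero> \<and> (x \<otimes> t) \<otimes> (x \<otimes> t) = x \<otimes> t"
    using t(1) fc by (intro bexI[of _ "t \<otimes> f"]) auto
qed

end

section \<open>The descending chain condition on right ideals\<close>

context ring
begin

text \<open>
  Nilpotence provides \<open>x\<close> outside \<open>T\<close> with \<open>xZ \<subseteq> T\<close>, where \<open>Z\<close> is the singular ideal, and \<open>e\<close> is chosen
  among the idempotents with \<open>xe \<notin> T\<close> so that \<open>(1 - e)R\<close> is maximal. Let \<open>y = xe\<close>. If \<open>z \<in> eR\<close> is not in
  \<open>Z\<close>, then \<open>zR\<close> contains a nonzero idempotent \<open>h\<close> of \<open>eRe\<close>. Maximality excludes \<open>e - h\<close> as a competitor, so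
  \<open>y - yh \<in> T\<close> and \<open>y \<in> T + yzR\<close>. Thus every element of \<open>T + yR\<close> outside \<open>T\<close> generates \<open>T + yR\<close>
  modulo \<open>T\<close>.
\<close>

lemma right_ideal_cover:
  assumes noeth: "right_noetherian R" and idem: "nonsingular_idempotents R"
    and nil: "singular_power m \<subseteq> {\<zero>}"
    and T: "right_ideal T R" "T \<noteq> carrier R"
  shows "\<exists>V. right_ideal V R \<and> T \<subset> V \<and> (\<forall>W. right_ideal W R \<and> T \<subset> W \<and> W \<subseteq> V \<longrightarrow> W = V)"
proof -
  note TD = right_idealD[OF T(1)]
  define j where "j = (LEAST j. singular_power j \<subseteq> T)"
  have "singular_power m \<subseteq> T" using nil TD(3) by blast
  then have j: "singular_power j \<subseteq> T" unfolding j_def by (rule LeastI)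
  have j_least: "\<not> singular_power i \<subseteq> T" if "i < j" for i
    using not_less_Least[OF that[unfolded j_def]] .
  have "j \<noteq> 0" using j T(2) TD(1) by (cases j) auto
  then obtain k where k: "j = Suc k" using not0_implies_Suc by blast
  then obtain x where x: "x \<in> singular_power k" "x \<notin> T" using j_least[of k] by blast
  have xc: "x \<in> carrier R" using x(1) singular_power_closed by blast
  have xZ: "x \<otimes> z \<in> T" if "z \<in> left_singular R" for z
    using j x(1) that unfolding k by auto
  define E where "E = {e \<in> carrier R. e \<otimes> e = e \<and> x \<otimes> e \<notin> T}"
  define F where "F = (\<lambda>e. PIdl\<^bsub>opposite R\<^esub> (\<one> \<ominus> e)) ` E"
  have "\<one> \<in> E" using xc x(2) by (simp add: E_def)
  then have F_ne: "F \<noteq> {}" by (auto simp: F_def)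
  have F_ideals: "right_ideal I R" if "I \<in> F" for I
    using that right_ideal_principal by (auto simp: F_def E_def)
  have "\<exists>M\<in>F. \<forall>I\<in>F. M \<subseteq> I \<longrightarrow> I = M"
    by (rule right_noetherian_maximal[OF noeth F_ne F_ideals])
  then obtain M where "M \<in> F" and M_max: "\<forall>I\<in>F. M \<subseteq> I \<longrightarrow> I = M" by (elim bexE)
  then obtain e where e: "e \<in> E" "M = PIdl\<^bsub>opposite R\<^esub> (\<one> \<ominus> e)" by (auto simp: F_def)
  have ec: "e \<in> carrier R" and ee: "e \<otimes> e = e" and xe: "x \<otimes> e \<notin> T" using e(1) by (auto simp: E_def)
  define y where "y = x \<otimes> e"
  have yc: "y \<in> carrier R" using xc ec by (simp add: y_def)
  have key: "\<exists>h\<in>carrier R. y \<ominus> y \<otimes> z \<otimes> h \<in> T"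
    if z: "z \<in> carrier R" "e \<otimes> z = z" "z \<notin> left_singular R" for z
  proof -
    obtain t where t: "t \<in> carrier R" "z \<otimes> t \<noteq> \<zero>" "(z \<otimes> t) \<otimes> (z \<otimes> t) = z \<otimes> t"
      using idem z unfolding nonsingular_idempotents_def by blast
    define g where "g = z \<otimes> t"
    have g: "g \<in> carrier R" "g \<noteq> \<zero>" "g \<otimes> g = g" using t z(1) by (simp_all add: g_def)
    have eg: "e \<otimes> g = g" using z(1,2) t(1) ec by (simp add: g_def m_assoc[symmetric])
    define h where "h = g \<otimes> e"
    have hc: "h \<in> carrier R" using g(1) ec by (simp add: h_def)
    have eh: "e \<otimes> h = h" using eg g(1) ec by (simp add: h_def m_assoc[symmetric])
    have he: "h \<otimes> e = h" using ee g(1) ec by (simp add: h_def m_assoc)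
    have "h \<otimes> h = g \<otimes> (e \<otimes> g) \<otimes> e" using g(1) ec by (simp add: h_def m_assoc)
    then have hh: "h \<otimes> h = h" unfolding eg g(3) by (simp add: h_def)
    have "h \<otimes> g = g \<otimes> (e \<otimes> g)" using g(1) ec by (simp add: h_def m_assoc)
    then have "h \<otimes> g = g" using eg g(3) by simp
    then have h0: "h \<noteq> \<zero>" using g by auto
    have "x \<otimes> (e \<ominus> h) \<in> T"
    proof (rule ccontr)
      assume "x \<otimes> (e \<ominus> h) \<notin> T"
      moreover have "(e \<ominus> h) \<otimes> (e \<ominus> h) = e \<ominus> h"
        using ec hc by (simp add: minus_eq l_distr r_distr l_minus r_minus ee eh he hh a_assoc r_neg l_neg r_neg1 r_neg2)
      ultimately have "PIdl\<^bsub>opposite R\<^esub> (\<one> \<ominus> (e \<ominus> h)) \<in> F" using ec hc by (simp add: F_def E_def)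
      moreover have "M \<subseteq> PIdl\<^bsub>opposite R\<^esub> (\<one> \<ominus> (e \<ominus> h))"
      proof
        fix v assume "v \<in> M"
        then obtain r where r: "r \<in> carrier R" "v = (\<one> \<ominus> e) \<otimes> r" by (auto simp: e(2) right_principal_def)
        have "(\<one> \<ominus> (e \<ominus> h)) \<otimes> (\<one> \<ominus> e) = \<one> \<ominus> e"
          using ec hc by (simp add: minus_eq l_distr r_distr l_minus r_minus minus_add ee he a_assoc r_neg l_neg r_neg1 r_neg2)
        then have "v = (\<one> \<ominus> (e \<ominus> h)) \<otimes> ((\<one> \<ominus> e) \<otimes> r)"
          using r ec hc by (simp add: m_assoc[symmetric])
        then show "v \<in> PIdl\<^bsub>opposite R\<^esub> (\<one> \<ominus> (e \<ominus> h))" using r(1) ec by (auto simp: right_principal_def)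
      qed
      ultimately have "PIdl\<^bsub>opposite R\<^esub> (\<one> \<ominus> (e \<ominus> h)) = M" using M_max by blast
      moreover have "(\<one> \<ominus> (e \<ominus> h)) \<otimes> h = h"
        using ec hc by (simp add: minus_eq l_distr l_minus minus_add eh hh a_assoc r_neg l_neg r_neg1 r_neg2)
      then have "h \<in> PIdl\<^bsub>opposite R\<^esub> (\<one> \<ominus> (e \<ominus> h))" using hc by (force simp: right_principal_def)
      ultimately obtain r where r: "r \<in> carrier R" "h = (\<one> \<ominus> e) \<otimes> r" by (auto simp: e(2) right_principal_def)
      have "e \<otimes> (\<one> \<ominus> e) = \<zero>" using ec by (simp add: minus_eq r_distr r_minus ee r_neg)
      moreover have "e \<otimes> h = (e \<otimes> (\<one> \<ominus> e)) \<otimes> r" using r ec by (simp add: m_assoc)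
      ultimately show False using eh h0 r(1) by simp
    qed
    moreover have "x \<otimes> (e \<ominus> h) = y \<ominus> y \<otimes> z \<otimes> (t \<otimes> e)"
    proof -
      have "y \<otimes> z \<otimes> (t \<otimes> e) = x \<otimes> (e \<otimes> h)"
        using xc ec z(1) t(1) by (simp add: y_def h_def g_def m_assoc)
      then have "y \<otimes> z \<otimes> (t \<otimes> e) = x \<otimes> h" using eh by simp
      then show ?thesis using xc ec hc by (simp add: y_def minus_eq r_distr r_minus)
    qed
    ultimately show ?thesis using t(1) ec by (intro bexI[of _ "t \<otimes> e"]) auto
  qed
  let ?V = "T <+>\<^bsub>R\<^esub> PIdl\<^bsub>opposite R\<^esub> y"
  note Y = right_ideal_principal[OF yc]
  note V = right_ideal_sum[OF T(1) Y]
  have yV: "y \<in> ?V" using V(3) ring.principal_self[OF opposite_ring, of y] yc by auto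
  have "W = ?V" if W: "right_ideal W R" "T \<subset> W" "W \<subseteq> ?V" for W
  proof -
    note WD = right_idealD[OF W(1)]
    obtain w where w: "w \<in> W" "w \<notin> T" using W(2) by blast
    then obtain t r where tr: "t \<in> T" "r \<in> carrier R" "w = t \<oplus> y \<otimes> r"
      using W(3) by (auto simp: set_add_def' right_principal_def)
    have yr: "y \<otimes> r = w \<ominus> t" unfolding tr(3) using TD(2)[OF tr(1)] yc tr(2) by (simp add: add_minus_cancel)
    then have yrW: "y \<otimes> r \<in> W" using WD(7) w(1) tr(1) W(2) by auto
    have yer: "y \<otimes> (e \<otimes> r) = y \<otimes> r" using xc ec ee tr(2) by (simp add: y_def m_assoc[symmetric]) (simp add: m_assoc ee)
    have "e \<otimes> r \<notin> left_singular R"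
    proof
      assume "e \<otimes> r \<in> left_singular R"
      then have "x \<otimes> (e \<otimes> r) \<in> T" by (rule xZ)
      then have "y \<otimes> r \<in> T" using xc ec tr(2) by (simp add: y_def m_assoc)
      then show False using w(2) tr TD(4) by auto
    qed
    moreover have "e \<otimes> (e \<otimes> r) = e \<otimes> r" using ec ee tr(2) by (simp add: m_assoc[symmetric])
    ultimately obtain h where h: "h \<in> carrier R" "y \<ominus> y \<otimes> (e \<otimes> r) \<otimes> h \<in> T"
      using key[of "e \<otimes> r"] ec tr(2) by auto
    have "y \<ominus> y \<otimes> r \<otimes> h \<in> W" using h W(2) unfolding yer by auto
    moreover have "y \<otimes> r \<otimes> h \<in> W" using WD(5)[OF h(1) yrW] .
    ultimately have "(y \<ominus> y \<otimes> r \<otimes> h) \<oplus> y \<otimes> r \<otimes> h \<in> W" by (rule WD(4))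
    then have yW: "y \<in> W" using yc tr(2) h(1) by (simp add: minus_eq a_assoc l_neg)
    have "?V \<subseteq> W"
    proof
      fix v assume "v \<in> ?V"
      then obtain a b where ab: "a \<in> T" "b \<in> carrier R" "v = a \<oplus> y \<otimes> b" by (auto simp: set_add_def' right_principal_def)
      then show "v \<in> W" using WD(4) WD(5)[OF ab(2) yW] W(2) by auto
    qed
    then show ?thesis using W(3) by blast
  qed
  moreover have "T \<subset> ?V" using V(2) yV xe by (auto simp: y_def)
  ultimately show ?thesis using V(1) by (intro exI[of _ ?V]) auto
qed

text \<open>
  Noetherian induction on a right ideal \<open>T\<close> contained in all members of the family. Let \<open>V\<close> cover \<open>T\<close>. By
  the induction hypothesis some \<open>D0 + V\<close> is minimal among the sums \<open>I + V\<close> with \<open>I\<close> in the family.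
  Consider the members \<open>D\<close> with \<open>D + V = D0 + V\<close>. If one of them meets \<open>V\<close> in \<open>T\<close> it is minimal by the
  modular law; otherwise they all contain \<open>V\<close> and coincide with \<open>D0 + V\<close>.
\<close>

lemma right_ideals_minimal:
  assumes noeth: "right_noetherian R"
    and cover: "\<And>T. \<lbrakk>right_ideal T R; T \<noteq> carrier R\<rbrakk> \<Longrightarrow>
      \<exists>V. right_ideal V R \<and> T \<subset> V \<and> (\<forall>W. right_ideal W R \<and> T \<subset> W \<and> W \<subseteq> V \<longrightarrow> W = V)"
    and ne: "F \<noteq> {}" and ideals: "\<And>I. I \<in> F \<Longrightarrow> right_ideal I R"
  shows "\<exists>M\<in>F. \<forall>I\<in>F. I \<subseteq> M \<longrightarrow> I = M"
proof (rule ccontr)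
  assume none: "\<not> ?thesis"
  define bad where "bad T \<longleftrightarrow> (\<exists>G. G \<noteq> {} \<and> (\<forall>I\<in>G. right_ideal I R \<and> T \<subseteq> I) \<and>
    \<not> (\<exists>M\<in>G. \<forall>I\<in>G. I \<subseteq> M \<longrightarrow> I = M))" for T
  have "bad {\<zero>}" unfolding bad_def
    by (rule exI[of _ F]) (use ne ideals none right_idealD(3) in auto)
  then have "{T. right_ideal T R \<and> bad T} \<noteq> {}" using right_ideal_zero by blast
  then have "\<exists>T\<in>{T. right_ideal T R \<and> bad T}. \<forall>I\<in>{T. right_ideal T R \<and> bad T}. T \<subseteq> I \<longrightarrow> I = T"
    by (rule right_noetherian_maximal[OF noeth]) simp
  then obtain T where T: "right_ideal T R" "bad T"
    and T_max: "\<forall>I. right_ideal I R \<and> bad I \<and> T \<subseteq> I \<longrightarrow> I = T" by auto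
  obtain G where G_ne: "G \<noteq> {}" and G_ideals: "\<forall>I\<in>G. right_ideal I R \<and> T \<subseteq> I"
    and G_none: "\<not> (\<exists>M\<in>G. \<forall>I\<in>G. I \<subseteq> M \<longrightarrow> I = M)"
    using T(2) unfolding bad_def by (elim exE conjE)
  have G: "G \<noteq> {}" "right_ideal I R" "T \<subseteq> I" if "I \<in> G" for I
    using that G_ideals by auto
  have T_ne: "T \<noteq> carrier R"
  proof
    assume "T = carrier R"
    then have "I = carrier R" if "I \<in> G" for I using G(3)[OF that] right_idealD(1)[OF G(2)[OF that]] by blast
    then show False using G_ne G_none by blast
  qed
  obtain V where V: "right_ideal V R" "T \<subset> V"
    and V_cover: "\<forall>W. right_ideal W R \<and> T \<subset> W \<and> W \<subseteq> V \<longrightarrow> W = V"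
    using cover[OF T(1) T_ne] by (elim exE conjE)
  have "\<not> bad V" using T_max V by (metis psubset_eq)
  define H where "H = (\<lambda>I. I <+>\<^bsub>R\<^esub> V) ` G"
  have "H \<noteq> {}" "\<forall>I\<in>H. right_ideal I R \<and> V \<subseteq> I"
    using G_ne right_ideal_sum(1,3)[OF G(2) V(1)] by (auto simp: H_def)
  then have "\<exists>M\<in>H. \<forall>I\<in>H. I \<subseteq> M \<longrightarrow> I = M" using \<open>\<not> bad V\<close> unfolding bad_def by blast
  then obtain D0 where D0: "D0 \<in> G" "\<forall>I\<in>G. I <+>\<^bsub>R\<^esub> V \<subseteq> D0 <+>\<^bsub>R\<^esub> V \<longrightarrow> I <+>\<^bsub>R\<^esub> V = D0 <+>\<^bsub>R\<^esub> V"
    unfolding H_def by auto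
  have sum_eq: "I <+>\<^bsub>R\<^esub> V = D0 <+>\<^bsub>R\<^esub> V"
    if "I \<in> G" "D \<in> G" "D <+>\<^bsub>R\<^esub> V = D0 <+>\<^bsub>R\<^esub> V" "I \<subseteq> D" for I D
  proof -
    have "I <+>\<^bsub>R\<^esub> V \<subseteq> D <+>\<^bsub>R\<^esub> V" using that(4) by (auto simp: set_add_def')
    then show ?thesis using D0(2) that by simp
  qed
  show False
  proof (cases "\<exists>D\<in>G. D <+>\<^bsub>R\<^esub> V = D0 <+>\<^bsub>R\<^esub> V \<and> \<not> V \<subseteq> D")
    case True
    then obtain D where D: "D \<in> G" "D <+>\<^bsub>R\<^esub> V = D0 <+>\<^bsub>R\<^esub> V" "\<not> V \<subseteq> D" by blast
    note DD = right_idealD[OF G(2)[OF D(1)]] and VD = right_idealD[OF V(1)]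
    have "right_ideal (D \<inter> V) R" by (rule right_idealI) (use DD VD in auto)
    then have DV: "D \<inter> V = T" using V_cover[rule_format, of "D \<inter> V"] G(3)[OF D(1)] V(2) D(3) by blast
    have "I = D" if I: "I \<in> G" "I \<subseteq> D" for I
    proof
      note ID = right_idealD[OF G(2)[OF I(1)]]
      show "D \<subseteq> I"
      proof
        fix d assume d: "d \<in> D"
        then have "d \<in> I <+>\<^bsub>R\<^esub> V"
          using sum_eq[OF I(1) D(1,2) I(2)] D(2) right_ideal_sum(2)[OF G(2)[OF D(1)] V(1)] by auto
        then obtain i v where iv: "i \<in> I" "v \<in> V" "d = i \<oplus> v" by (auto simp: set_add_def')
        have "v = d \<ominus> i" unfolding iv(3) using ID(2)[OF iv(1)] VD(2)[OF iv(2)] by (simp add: add_minus_cancel)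
        then have "v \<in> D" using DD(7)[OF d] iv(1) I(2) by auto
        then have "v \<in> I" using iv(2) DV G(3)[OF I(1)] by blast
        then show "d \<in> I" using iv ID(4) by simp
      qed
    qed (rule I(2))
    then show False using G_none D(1) by blast
  next
    case False
    have absorb: "D = D0 <+>\<^bsub>R\<^esub> V" if "D \<in> G" "D <+>\<^bsub>R\<^esub> V = D0 <+>\<^bsub>R\<^esub> V" for D
    proof -
      note DD = right_idealD[OF G(2)[OF that(1)]]
      have "V \<subseteq> D" using False that by blast
      then have "D <+>\<^bsub>R\<^esub> V \<subseteq> D" using DD(4) by (auto simp: set_add_def')
      then show ?thesis using right_ideal_sum(2)[OF G(2)[OF that(1)] V(1)] that(2) by blast
    qed
    have "I = D0" if "I \<in> G" "I \<subseteq> D0" for I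
      using absorb[OF that(1) sum_eq[OF that(1) D0(1) refl that(2)]] absorb[OF D0(1) refl] by simp
    then show False using G_none D0(1) by blast
  qed
qed

text \<open>
  For finite \<open>K \<subseteq> I\<close> the elements \<open>w\<close> with \<open>f k = kw\<close> on \<open>K\<close> form a coset of \<open>r K\<close>. If \<open>r K\<close> is minimal, adding
  an element of \<open>I\<close> to \<open>K\<close> leaves this coset unchanged, so a solution on \<open>K\<close> is a solution on \<open>I\<close>.
\<close>

lemma f_injective_artinian_imp_baer:
  assumes inj: "left_f_injective R"
    and minimal: "\<And>F. \<lbrakk>F \<noteq> {}; \<And>I. I \<in> F \<Longrightarrow> right_ideal I R\<rbrakk> \<Longrightarrow> \<exists>M\<in>F. \<forall>I\<in>F. I \<subseteq> M \<longrightarrow> I = M"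
  shows "left_baer R"
  unfolding left_baer_def
proof (intro allI impI, elim conjE)
  fix I f assume I: "left_ideal I R" and f: "f \<in> ideal_homs R I"
  note ID = left_idealD[OF I]
  have ext: "\<exists>w\<in>carrier R. \<forall>x\<in>K. f x = x \<otimes> w" if "finite K" "K \<subseteq> I" for K
    using inj I f that unfolding left_f_injective_def by blast
  let ?F = "right_ann R ` {K. finite K \<and> K \<subseteq> I}"
  have "\<exists>M\<in>?F. \<forall>J\<in>?F. J \<subseteq> M \<longrightarrow> J = M"
  proof (rule minimal)
    show "?F \<noteq> {}" by auto
    show "right_ideal J R" if "J \<in> ?F" for J using that right_ideal_right_ann ID(1) by blast
  qed
  then obtain K where K: "finite K" "K \<subseteq> I"
    and K_min: "\<And>L. \<lbrakk>finite L; L \<subseteq> I; right_ann R L \<subseteq> right_ann R K\<rbrakk> \<Longrightarrow> right_ann R L = right_ann R K"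
    by auto
  obtain w where w: "w \<in> carrier R" "\<forall>x\<in>K. f x = x \<otimes> w" using ext[OF K] by blast
  have "f x = x \<otimes> w" if x: "x \<in> I" for x
  proof -
    have L: "finite (insert x K)" "insert x K \<subseteq> I" using K x by auto
    obtain w' where w': "w' \<in> carrier R" "\<forall>z\<in>insert x K. f z = z \<otimes> w'" using ext[OF L] by blast
    have "z \<otimes> (w' \<ominus> w) = \<zero>" if "z \<in> K" for z
    proof -
      have zc: "z \<in> carrier R" using that K(2) ID(2) by blast
      have "z \<otimes> w' = z \<otimes> w" using that w(2) w'(2) by auto
      moreover have "z \<otimes> (w' \<ominus> w) = z \<otimes> w' \<ominus> z \<otimes> w" using zc w(1) w'(1) by (simp add: minus_eq r_distr r_minus)
      ultimately show ?thesis using zc w(1) by simp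
    qed
    then have "w' \<ominus> w \<in> right_ann R K" using w(1) w'(1) by (simp add: left_ann_def)
    moreover have "right_ann R (insert x K) = right_ann R K" by (rule K_min[OF L]) (auto simp: left_ann_def)
    ultimately have "x \<otimes> (w' \<ominus> w) = \<zero>" by (auto simp: left_ann_def)
    moreover have "x \<otimes> (w' \<ominus> w) = x \<otimes> w' \<ominus> x \<otimes> w" using ID(2)[OF x] w(1) w'(1) by (simp add: minus_eq r_distr r_minus)
    ultimately have "x \<otimes> w' = x \<otimes> w" using ID(2)[OF x] w(1) w'(1) by simp
    then show ?thesis using w'(2) by simp
  qed
  then show "\<exists>w\<in>carrier R. \<forall>x\<in>I. f x = x \<otimes> w" using w(1) by blast
qed

end

section \<open>Baer's criterion\<close>

context left_module
begin

lemma add_smult_cancel: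
  assumes "x \<in> carrier M" "y \<in> carrier M" "r \<in> carrier R"
    and "x \<oplus>\<^bsub>M\<^esub> r \<odot>\<^bsub>M\<^esub> y = \<zero>\<^bsub>M\<^esub>"
  shows "r \<odot>\<^bsub>M\<^esub> y = (\<ominus>\<^bsub>R\<^esub> \<one>\<^bsub>R\<^esub>) \<odot>\<^bsub>M\<^esub> x"
  using assms by (metis M.minus_equality M.add.m_comm smult_closed smult_l_minus_one)

end

text \<open>
  The graphs of partial homomorphisms to the ring, to which Zorn's lemma applies with respect to
  inclusion. By additivity it is enough to require uniqueness of values at \<open>0\<close>.
\<close>

definition hom_graph :: "('a, 'r) ring_scheme \<Rightarrow> ('a, 'm, 'x) module_scheme \<Rightarrow> ('m \<times> 'a) set \<Rightarrow> bool" where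
  "hom_graph R M G \<longleftrightarrow> G \<subseteq> carrier M \<times> carrier R \<and>
     (\<forall>x y x' y'. (x, y) \<in> G \<longrightarrow> (x', y') \<in> G \<longrightarrow> (x \<oplus>\<^bsub>M\<^esub> x', y \<oplus>\<^bsub>R\<^esub> y') \<in> G) \<and>
     (\<forall>r x y. r \<in> carrier R \<longrightarrow> (x, y) \<in> G \<longrightarrow> (r \<odot>\<^bsub>M\<^esub> x, r \<otimes>\<^bsub>R\<^esub> y) \<in> G) \<and>
     (\<forall>y. (\<zero>\<^bsub>M\<^esub>, y) \<in> G \<longrightarrow> y = \<zero>\<^bsub>R\<^esub>)"

lemma hom_graphD:
  assumes "hom_graph R M G"
  shows "\<And>x y. (x, y) \<in> G \<Longrightarrow> x \<in> carrier M" "\<And>x y. (x, y) \<in> G \<Longrightarrow> y \<in> carrier R"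
    "\<And>x y x' y'. \<lbrakk>(x, y) \<in> G; (x', y') \<in> G\<rbrakk> \<Longrightarrow> (x \<oplus>\<^bsub>M\<^esub> x', y \<oplus>\<^bsub>R\<^esub> y') \<in> G"
    "\<And>r x y. \<lbrakk>r \<in> carrier R; (x, y) \<in> G\<rbrakk> \<Longrightarrow> (r \<odot>\<^bsub>M\<^esub> x, r \<otimes>\<^bsub>R\<^esub> y) \<in> G"
    "\<And>y. (\<zero>\<^bsub>M\<^esub>, y) \<in> G \<Longrightarrow> y = \<zero>\<^bsub>R\<^esub>"
  using assms unfolding hom_graph_def by auto

context left_module
begin

lemma hom_graph_unique:
  assumes G: "hom_graph R M G" and xy: "(x, y) \<in> G" "(x, y') \<in> G"
  shows "y = y'"
proof -
  note GD = hom_graphD[OF G]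
  have c: "x \<in> carrier M" "y \<in> carrier R" "y' \<in> carrier R" using GD(1,2) xy by blast+
  have "(x \<oplus>\<^bsub>M\<^esub> (\<ominus>\<^bsub>R\<^esub> \<one>\<^bsub>R\<^esub>) \<odot>\<^bsub>M\<^esub> x, y \<oplus>\<^bsub>R\<^esub> (\<ominus>\<^bsub>R\<^esub> \<one>\<^bsub>R\<^esub>) \<otimes>\<^bsub>R\<^esub> y') \<in> G"
    using GD(3)[OF xy(1) GD(4)[OF _ xy(2)]] by simp
  moreover have "x \<oplus>\<^bsub>M\<^esub> (\<ominus>\<^bsub>R\<^esub> \<one>\<^bsub>R\<^esub>) \<odot>\<^bsub>M\<^esub> x = \<zero>\<^bsub>M\<^esub>"
    using c by (simp add: smult_l_minus_one M.r_neg)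
  moreover have "y \<oplus>\<^bsub>R\<^esub> (\<ominus>\<^bsub>R\<^esub> \<one>\<^bsub>R\<^esub>) \<otimes>\<^bsub>R\<^esub> y' = y \<ominus>\<^bsub>R\<^esub> y'"
    using c by (simp add: R.minus_eq R.l_minus)
  ultimately have "y \<ominus>\<^bsub>R\<^esub> y' = \<zero>\<^bsub>R\<^esub>" using GD(5) by simp
  then show ?thesis using c by simp
qed

text \<open>
  The ring elements \<open>r\<close> for which \<open>rm\<close> lies in the domain of \<open>G\<close> form a left ideal, on which the value at
  \<open>rm\<close> is \<open>rw\<close> for a fixed \<open>w\<close>. Hence \<open>w\<close> is a consistent choice of value at \<open>m\<close>.
\<close>

lemma hom_graph_extend:
  assumes baer: "left_baer R" and G: "hom_graph R M G" "G \<noteq> {}" and m: "m \<in> carrier M"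
  shows "\<exists>H w. hom_graph R M H \<and> G \<subseteq> H \<and> (m, w) \<in> H"
proof -
  note GD = hom_graphD[OF G(1)]
  obtain x0 y0 where "(x0, y0) \<in> G" using G(2) by auto
  then have "(\<zero>\<^bsub>R\<^esub> \<odot>\<^bsub>M\<^esub> x0, \<zero>\<^bsub>R\<^esub> \<otimes>\<^bsub>R\<^esub> y0) \<in> G" "x0 \<in> carrier M" "y0 \<in> carrier R"
    using GD(1,2) GD(4)[of "\<zero>\<^bsub>R\<^esub>"] by auto
  then have zero: "(\<zero>\<^bsub>M\<^esub>, \<zero>\<^bsub>R\<^esub>) \<in> G" by (simp add: smult_l_zero)
  define I where "I = {r \<in> carrier R. \<exists>y. (r \<odot>\<^bsub>M\<^esub> m, y) \<in> G}"
  have I: "left_ideal I R"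
  proof (rule R.left_idealI)
    show "I \<subseteq> carrier R" by (auto simp: I_def)
    show "\<zero>\<^bsub>R\<^esub> \<in> I" using zero m by (auto simp: I_def smult_l_zero)
    show "a \<oplus>\<^bsub>R\<^esub> b \<in> I" if "a \<in> I" "b \<in> I" for a b
      using that m GD(3) by (auto simp: I_def smult_l_distr) blast
    show "r \<otimes>\<^bsub>R\<^esub> a \<in> I" if "r \<in> carrier R" "a \<in> I" for r a
      using that m GD(4) by (auto simp: I_def smult_assoc)
  qed
  define f where "f r = (THE y. (r \<odot>\<^bsub>M\<^esub> m, y) \<in> G)" for r
  have f_eq: "f r = y" if "(r \<odot>\<^bsub>M\<^esub> m, y) \<in> G" for r y
    unfolding f_def using that hom_graph_unique[OF G(1)] by blast
  have f: "(r \<odot>\<^bsub>M\<^esub> m, f r) \<in> G" if "r \<in> I" for r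
    using that f_eq by (auto simp: I_def)
  have "f \<in> ideal_homs R I"
    unfolding ideal_homs_iff
  proof (intro conjI ballI)
    show "f \<in> I \<rightarrow> carrier R" using f GD(2) by blast
    show "f (x \<oplus>\<^bsub>R\<^esub> y) = f x \<oplus>\<^bsub>R\<^esub> f y" if "x \<in> I" "y \<in> I" for x y
      using GD(3)[OF f[OF that(1)] f[OF that(2)]] that m by (intro f_eq) (simp add: I_def smult_l_distr)
    show "f (r \<otimes>\<^bsub>R\<^esub> x) = r \<otimes>\<^bsub>R\<^esub> f x" if "r \<in> carrier R" "x \<in> I" for r x
      using GD(4)[OF that(1) f[OF that(2)]] that m by (intro f_eq) (simp add: I_def smult_assoc)
  qed
  then obtain w where w: "w \<in> carrier R" "\<forall>r\<in>I. f r = r \<otimes>\<^bsub>R\<^esub> w"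
    using baer[unfolded left_baer_def, rule_format, OF conjI[OF I]] by auto
  define H where "H = {(x \<oplus>\<^bsub>M\<^esub> r \<odot>\<^bsub>M\<^esub> m, y \<oplus>\<^bsub>R\<^esub> r \<otimes>\<^bsub>R\<^esub> w) |x y r. (x, y) \<in> G \<and> r \<in> carrier R}"
  have HI: "(x \<oplus>\<^bsub>M\<^esub> r \<odot>\<^bsub>M\<^esub> m, y \<oplus>\<^bsub>R\<^esub> r \<otimes>\<^bsub>R\<^esub> w) \<in> H" if "(x, y) \<in> G" "r \<in> carrier R" for x y r
    using that by (auto simp: H_def)
  have HE: "\<exists>x y r. (x, y) \<in> G \<and> r \<in> carrier R \<and> p = x \<oplus>\<^bsub>M\<^esub> r \<odot>\<^bsub>M\<^esub> m \<and> q = y \<oplus>\<^bsub>R\<^esub> r \<otimes>\<^bsub>R\<^esub> w"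
    if "(p, q) \<in> H" for p q
    using that by (auto simp: H_def)
  have "hom_graph R M H"
    unfolding hom_graph_def
  proof (intro conjI allI impI)
    show "H \<subseteq> carrier M \<times> carrier R" using GD(1,2) m w(1) by (auto simp: H_def)
    show "(p \<oplus>\<^bsub>M\<^esub> p', q \<oplus>\<^bsub>R\<^esub> q') \<in> H" if pq: "(p, q) \<in> H" "(p', q') \<in> H" for p q p' q'
    proof -
      obtain x y r where 1: "(x, y) \<in> G" "r \<in> carrier R" "p = x \<oplus>\<^bsub>M\<^esub> r \<odot>\<^bsub>M\<^esub> m" "q = y \<oplus>\<^bsub>R\<^esub> r \<otimes>\<^bsub>R\<^esub> w"
        using HE[OF pq(1)] by blast
      obtain x' y' r' where 2: "(x', y') \<in> G" "r' \<in> carrier R" "p' = x' \<oplus>\<^bsub>M\<^esub> r' \<odot>\<^bsub>M\<^esub> m" "q' = y' \<oplus>\<^bsub>R\<^esub> r' \<otimes>\<^bsub>R\<^esub> w"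
        using HE[OF pq(2)] by blast
      note c = GD(1)[OF 1(1)] GD(2)[OF 1(1)] GD(1)[OF 2(1)] GD(2)[OF 2(1)] 1(2) 2(2)
      have "p \<oplus>\<^bsub>M\<^esub> p' = (x \<oplus>\<^bsub>M\<^esub> x') \<oplus>\<^bsub>M\<^esub> (r \<oplus>\<^bsub>R\<^esub> r') \<odot>\<^bsub>M\<^esub> m"
        using c m by (simp add: 1 2 smult_l_distr M.a_ac)
      moreover have "q \<oplus>\<^bsub>R\<^esub> q' = (y \<oplus>\<^bsub>R\<^esub> y') \<oplus>\<^bsub>R\<^esub> (r \<oplus>\<^bsub>R\<^esub> r') \<otimes>\<^bsub>R\<^esub> w"
        using c w(1) by (simp add: 1 2 R.l_distr R.a_ac)
      ultimately show ?thesis using HI[OF GD(3)[OF 1(1) 2(1)], of "r \<oplus>\<^bsub>R\<^esub> r'"] c by simp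
    qed
    show "(s \<odot>\<^bsub>M\<^esub> p, s \<otimes>\<^bsub>R\<^esub> q) \<in> H" if s: "s \<in> carrier R" "(p, q) \<in> H" for s p q
    proof -
      obtain x y r where 1: "(x, y) \<in> G" "r \<in> carrier R" "p = x \<oplus>\<^bsub>M\<^esub> r \<odot>\<^bsub>M\<^esub> m" "q = y \<oplus>\<^bsub>R\<^esub> r \<otimes>\<^bsub>R\<^esub> w"
        using HE[OF s(2)] by blast
      note c = GD(1)[OF 1(1)] GD(2)[OF 1(1)] 1(2)
      have "s \<odot>\<^bsub>M\<^esub> p = s \<odot>\<^bsub>M\<^esub> x \<oplus>\<^bsub>M\<^esub> (s \<otimes>\<^bsub>R\<^esub> r) \<odot>\<^bsub>M\<^esub> m"
        using c m s(1) by (simp add: 1 smult_r_distr smult_assoc)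
      moreover have "s \<otimes>\<^bsub>R\<^esub> q = s \<otimes>\<^bsub>R\<^esub> y \<oplus>\<^bsub>R\<^esub> (s \<otimes>\<^bsub>R\<^esub> r) \<otimes>\<^bsub>R\<^esub> w"
        using c w(1) s(1) by (simp add: 1 R.r_distr R.m_assoc)
      ultimately show ?thesis using HI[OF GD(4)[OF s(1) 1(1)], of "s \<otimes>\<^bsub>R\<^esub> r"] c s(1) by simp
    qed
    show "q = \<zero>\<^bsub>R\<^esub>" if q: "(\<zero>\<^bsub>M\<^esub>, q) \<in> H" for q
    proof -
      obtain x y r where 1: "(x, y) \<in> G" "r \<in> carrier R" "\<zero>\<^bsub>M\<^esub> = x \<oplus>\<^bsub>M\<^esub> r \<odot>\<^bsub>M\<^esub> m" "q = y \<oplus>\<^bsub>R\<^esub> r \<otimes>\<^bsub>R\<^esub> w"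
        using HE[OF q] by blast
      note c = GD(1)[OF 1(1)] GD(2)[OF 1(1)]
      have "r \<odot>\<^bsub>M\<^esub> m = (\<ominus>\<^bsub>R\<^esub> \<one>\<^bsub>R\<^esub>) \<odot>\<^bsub>M\<^esub> x"
        using add_smult_cancel[OF c(1) m 1(2) 1(3)[symmetric]] .
      then have rm: "(r \<odot>\<^bsub>M\<^esub> m, (\<ominus>\<^bsub>R\<^esub> \<one>\<^bsub>R\<^esub>) \<otimes>\<^bsub>R\<^esub> y) \<in> G" using GD(4)[OF _ 1(1), of "\<ominus>\<^bsub>R\<^esub> \<one>\<^bsub>R\<^esub>"] by simp
      then have "r \<in> I" using 1(2) by (auto simp: I_def)
      then have "r \<otimes>\<^bsub>R\<^esub> w = \<ominus>\<^bsub>R\<^esub> y" using w(2) f_eq[OF rm] c(2) by (simp add: R.l_minus)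
      then show ?thesis using 1(4) c(2) by (simp add: R.r_neg)
    qed
  qed
  moreover have "G \<subseteq> H"
  proof (rule subrelI)
    fix x y assume xy: "(x, y) \<in> G"
    show "(x, y) \<in> H" using HI[OF xy R.zero_closed] GD(1,2)[OF xy] m w(1) by (simp add: smult_l_zero)
  qed
  moreover have "(m, w) \<in> H" using HI[OF zero R.one_closed] m w(1) by simp
  ultimately show ?thesis by blast
qed

lemma hom_graph_maximal:
  assumes G: "hom_graph R M G"
  shows "\<exists>H. hom_graph R M H \<and> G \<subseteq> H \<and> (\<forall>H'. hom_graph R M H' \<and> H \<subseteq> H' \<longrightarrow> H' = H)"
proof -
  define F where "F = {H. hom_graph R M H \<and> G \<subseteq> H}"
  have "\<exists>H\<in>F. \<forall>X\<in>F. H \<subseteq> X \<longrightarrow> X = H"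
  proof (rule subset_Zorn_nonempty)
    show "F \<noteq> {}" using G by (auto simp: F_def)
    fix K assume K: "K \<noteq> {}" "subset.chain F K"
    have KF: "hom_graph R M X" "G \<subseteq> X" if "X \<in> K" for X
      using that K(2) by (auto simp: subset.chain_def F_def)
    have pair: "\<exists>X\<in>K. p \<in> X \<and> q \<in> X" if "p \<in> \<Union>K" "q \<in> \<Union>K" for p q
      using that K(2) unfolding subset.chain_def by blast
    have "hom_graph R M (\<Union>K)"
      unfolding hom_graph_def
    proof (intro conjI allI impI)
      show "\<Union>K \<subseteq> carrier M \<times> carrier R"
      proof (rule subrelI)
        fix x y assume "(x, y) \<in> \<Union>K"
        then obtain X where "X \<in> K" "(x, y) \<in> X" by blast
        then show "(x, y) \<in> carrier M \<times> carrier R" using hom_graphD(1,2)[OF KF(1)] by auto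
      qed
      show "(x \<oplus>\<^bsub>M\<^esub> x', y \<oplus>\<^bsub>R\<^esub> y') \<in> \<Union>K" if xy: "(x, y) \<in> \<Union>K" "(x', y') \<in> \<Union>K" for x y x' y'
      proof -
        obtain X where "X \<in> K" "(x, y) \<in> X" "(x', y') \<in> X" using pair[OF xy] by blast
        then show ?thesis using hom_graphD(3)[OF KF(1)] by (intro UnionI[of X])
      qed
      show "(r \<odot>\<^bsub>M\<^esub> x, r \<otimes>\<^bsub>R\<^esub> y) \<in> \<Union>K" if r: "r \<in> carrier R" and xy: "(x, y) \<in> \<Union>K" for r x y
      proof -
        obtain X where "X \<in> K" "(x, y) \<in> X" using xy by blast
        then show ?thesis using hom_graphD(4)[OF KF(1)] r by (intro UnionI[of X])
      qed
      show "y = \<zero>\<^bsub>R\<^esub>" if y: "(\<zero>\<^bsub>M\<^esub>, y) \<in> \<Union>K" for y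
      proof -
        obtain X where "X \<in> K" "(\<zero>\<^bsub>M\<^esub>, y) \<in> X" using y by blast
        then show ?thesis using hom_graphD(5)[OF KF(1)] by blast
      qed
    qed
    then show "\<Union>K \<in> F" using K(1) KF(2) by (auto simp: F_def)
  qed
  then obtain H where H: "H \<in> F" "\<forall>X\<in>F. H \<subseteq> X \<longrightarrow> X = H" by (elim bexE)
  then have GH: "G \<subseteq> H" by (simp add: F_def)
  show ?thesis
  proof (intro exI conjI allI impI)
    show "H' = H" if "hom_graph R M H' \<and> H \<subseteq> H'" for H'
      using H(2) GH that by (auto simp: F_def)
  qed (use H(1) in \<open>simp_all add: F_def\<close>)
qed

lemma left_baer_extend:
  assumes baer: "left_baer R" and N: "submodule N R M"
    and f: "f \<in> left_hom R (M\<lparr>carrier := N\<rparr>) (left_regular R)"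
  shows "\<exists>g\<in>left_hom R M (left_regular R). \<forall>x\<in>N. g x = f x"
proof -
  have N': "N \<subseteq> carrier M" "\<zero>\<^bsub>M\<^esub> \<in> N" "\<And>x y. \<lbrakk>x \<in> N; y \<in> N\<rbrakk> \<Longrightarrow> x \<oplus>\<^bsub>M\<^esub> y \<in> N"
    "\<And>a x. \<lbrakk>a \<in> carrier R; x \<in> N\<rbrakk> \<Longrightarrow> a \<odot>\<^bsub>M\<^esub> x \<in> N"
    using N unfolding submodule_iff by auto
  note fD = left_homD[OF f, simplified]
  define G where "G = (\<lambda>x. (x, f x)) ` N"
  have "f \<zero>\<^bsub>M\<^esub> = \<zero>\<^bsub>R\<^esub>" using fD(3)[OF R.zero_closed N'(2)] fD(1)[OF N'(2)] by (simp add: smult_l_zero)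
  then have G: "hom_graph R M G"
    using N' fD by (auto simp: hom_graph_def G_def)
  obtain H where H: "hom_graph R M H" "G \<subseteq> H" and H_max: "\<forall>H'. hom_graph R M H' \<and> H \<subseteq> H' \<longrightarrow> H' = H"
    using hom_graph_maximal[OF G] by (elim exE conjE)
  have "H \<noteq> {}" using H(2) N'(2) by (auto simp: G_def)
  have total: "\<exists>y. (x, y) \<in> H" if x: "x \<in> carrier M" for x
  proof -
    obtain H' w where "hom_graph R M H'" "H \<subseteq> H'" "(x, w) \<in> H'"
      using hom_graph_extend[OF baer H(1) \<open>H \<noteq> {}\<close> x] by blast
    then show ?thesis using H_max by blast
  qed
  define g where "g x = (THE y. (x, y) \<in> H)" for x
  have g_eq: "g x = y" if "(x, y) \<in> H" for x y
    unfolding g_def using that hom_graph_unique[OF H(1)] by blast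
  have g: "(x, g x) \<in> H" if "x \<in> carrier M" for x
    using total[OF that] g_eq by auto
  note HD = hom_graphD[OF H(1)]
  show ?thesis
  proof (intro bexI[of _ g] ballI)
    show "g x = f x" if "x \<in> N" for x using that H(2) by (intro g_eq) (auto simp: G_def)
    have "g (x \<oplus>\<^bsub>M\<^esub> y) = g x \<oplus>\<^bsub>R\<^esub> g y" if "x \<in> carrier M" "y \<in> carrier M" for x y
      using HD(3)[OF g[OF that(1)] g[OF that(2)]] by (rule g_eq)
    moreover have "g (a \<odot>\<^bsub>M\<^esub> x) = a \<otimes>\<^bsub>R\<^esub> g x" if "a \<in> carrier R" "x \<in> carrier M" for a x
      using HD(4)[OF that(1) g[OF that(2)]] by (rule g_eq)
    moreover have "g x \<in> carrier R" if "x \<in> carrier M" for x using HD(2)[OF g[OF that]] .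
    ultimately show "g \<in> left_hom R M (left_regular R)" by (simp add: left_hom_def)
  qed
qed

end

lemma left_baer_imp_left_self_injective:
  fixes R :: "('a, 'r) ring_scheme"
  assumes "left_baer R"
  shows "left_self_injective (TYPE('m)) R"
  unfolding left_self_injective_def
proof (intro allI impI, elim conjE)
  fix M :: "('a, 'm) module" and N f
  assume "left_module R M" "submodule N R M" "f \<in> left_hom R (M\<lparr>carrier := N\<rparr>) (left_regular R)"
  then show "\<exists>g\<in>left_hom R M (left_regular R). \<forall>x\<in>N. g x = f x"
    using left_module.left_baer_extend[OF _ assms] by blast
qed

section \<open>The characterization of quasi-Frobenius rings\<close>

theorem corollary2p5:
  fixes R :: "('a, 'r) ring_scheme"
  assumes "ring R"
    and "right_noetherian R"
    and "left_fp_injective TYPE(('a, 'm) module_universe) R"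
  shows "quasi_frobenius TYPE(('a, 'm) module_universe) R \<longleftrightarrow>
    (\<forall>C. complement_left_ideal C R \<and> C \<noteq> {\<zero>\<^bsub>R\<^esub>} \<longrightarrow> \<not> small_left_ideal C R)"
proof -
  interpret ring R by fact
  note noeth = assms(2) and fp = assms(3)
  have f_inj: "left_f_injective R" using left_fp_injective_imp_f_injective[OF fp] .
  note ann = right_ideal_annihilator[OF fp noeth]
  have p_inj: "left_p_injective R" using annihilator_imp_p_injective[OF ann] .
  obtain m where m: "singular_power m \<subseteq> {\<zero>\<^bsub>R\<^esub>}" using singular_power_nilpotent[OF p_inj noeth ann] ..
  have nil: "left_singular_nil R"
    unfolding left_singular_nil_def using pow_singular_power[of _ m] m by blast
  have baer: "left_baer R" if "nonsingular_idempotents R"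
    using f_injective_artinian_imp_baer[OF f_inj]
      right_ideals_minimal[OF noeth right_ideal_cover[OF noeth that m]] by blast
  show ?thesis
  proof
    assume qf: "quasi_frobenius TYPE(('a, 'm) module_universe) R"
    have "left_baer R"
    proof (cases "left_self_injective TYPE(('a, 'm) module_universe) R")
      case True
      then show ?thesis by (rule left_self_injective_imp_baer)
    next
      case False
      then have "left_self_injective TYPE(('a, 'm) module_universe) (opposite R)"
        using qf unfolding quasi_frobenius_def right_self_injective_def by blast
      then have "left_baer (opposite R)"
        by (rule ring.left_self_injective_imp_baer[OF opposite_ring])
      then show ?thesis by (intro baer right_baer_imp_nonsingular_idempotents[OF _ p_inj nil])
    qed
    then show "\<forall>C. complement_left_ideal C R \<and> C \<noteq> {\<zero>\<^bsub>R\<^esub>} \<longrightarrow> \<not> small_left_ideal C R"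
      using left_baer_imp_complement_not_small[OF _ nil] by blast
  next
    assume "\<forall>C. complement_left_ideal C R \<and> C \<noteq> {\<zero>\<^bsub>R\<^esub>} \<longrightarrow> \<not> small_left_ideal C R"
    then have "nonsingular_idempotents R"
      using not_small_complements_imp_nonsingular_idempotents[OF f_inj p_inj nil noeth] by blast
    then have "left_self_injective TYPE(('a, 'm) module_universe) R"
      by (intro left_baer_imp_left_self_injective baer)
    then show "quasi_frobenius TYPE(('a, 'm) module_universe) R"
      using ring_axioms noeth unfolding quasi_frobenius_def by blast
  qed
qed

end
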